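(* Let $G=(V,E)$ be a simple undirected graph with $V=[n]$, $N=\binom n2$, $\mathcal P_n=\{(i,j):i<j\}$ enumerated as $(i_k,j_k)$, $k\in[N]$, $\sigma^*$ a permutation of $[n]$ and $y_k=\operatorname{sign}(\sigma^*(i_k)-\sigma^*(j_k))$. Let $U=[u_1,\dots,u_n]\in\mathrm{Lab}(G)$, $K=U^\top U$, and let $\tilde U\in\mathbb R^{d^2\times N}$ have columns $\tilde u_k=u_{i_k}\otimes u_{j_k}$. Fix $C>0$, $f\in(0,1/2]$, $m=\lceil Nf\rceil$, let $S\subseteq\mathcal P_n$ with $|S|=m$ be drawn uniformly at random with labels revealed, $\bar S=\mathcal P_n\setminus S$, and let $\ell^\rho:\{\pm1\}\times\mathbb R\to[0,B]$ be a bounded loss, $\rho$-Lipschitz in its second argument ($|\ell^\rho(y,a)-\ell^\rho(y,a')|\le\frac1\rho|a-a'|$). Let $f^*=\tilde U^\top w^*$ be the score vector output by Pref-Rank on $(\tilde U,S,\{y_k\}_{k\in S})$. Then there is a constant $C_1>0$ such that for any $\delta>0$, with probability at least $1-\delta$ over $S$, $$er^{\ell^\rho}_{\bar S}(f^* )\le er^{\ell^\rho}_S(f^* )+\frac{C\lambda_1(K)\sqrt2}{\rho\sqrt{f(1-f)}}+\frac{C_1B}{1-f}\sqrt{\frac{\log(1/\delta)}{Nf}}.$$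
   Context: $\mathrm{Lab}(G)$: matrices $U=[u_1,\dots,u_n]\in\mathbb R^{d\times n}$ with unit columns and $u_i^\top u_j=0$ whenever $i\ne j$, $(i,j)\notin E$. $\lambda_1(K)$ is the largest eigenvalue of $K$. Pref-Rank with embedding $\tilde U$ and parameter $C$: $w^*\in\arg\min_w\frac12\|w\|_2^2+C\sum_{k\in S}\max(0,1-y_kw^\top\tilde u_k)$, output $f^*=\tilde U^\top w^*$. $er^\ell_S(g)=\frac1{|S|}\sum_{k\in S}\ell(y_k,g_k)$, $er^\ell_{\bar S}(g)=\frac1{|\bar S|}\sum_{k\in\bar S}\ell(y_k,g_k)$. *)

theory Defs
  imports "Jordan_Normal_Form.Char_Poly" "HOL-Probability.Probability_Mass_Function"
begin

definition simple_graph :: "nat \<Rightarrow> (nat \<Rightarrow> nat \<Rightarrow> bool) \<Rightarrow> bool" where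
  "simple_graph n E \<longleftrightarrow> (\<forall>i j. E i j \<longrightarrow> E j i) \<and> (\<forall>i. \<not> E i i)
      \<and> (\<forall>i j. E i j \<longrightarrow> i < n \<and> j < n)"

definition pairs :: "nat \<Rightarrow> (nat \<times> nat) set" where
  "pairs n = {(i, j). i < j \<and> j < n}"

definition in_Lab :: "nat \<Rightarrow> (nat \<Rightarrow> nat \<Rightarrow> bool) \<Rightarrow> real mat \<Rightarrow> bool" where
  "in_Lab n E U \<longleftrightarrow> dim_col U = n
     \<and> (\<forall>i<n. scalar_prod (col U i) (col U i) = 1)
     \<and> (\<forall>i<n. \<forall>j<n. i \<noteq> j \<and> \<not> E i j \<longrightarrow> scalar_prod (col U i) (col U j) = 0)"

definition lambda1 :: "real mat \<Rightarrow> real" where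
  "lambda1 K = Max {k. eigenvalue K k}"

definition kron_col :: "real mat \<Rightarrow> nat \<Rightarrow> nat \<Rightarrow> real Matrix.vec" where
  "kron_col U i j = Matrix.vec (dim_row U * dim_row U)
     (\<lambda>t. U $$ (t div dim_row U, i) * U $$ (t mod dim_row U, j))"

definition hinge :: "real \<Rightarrow> real" where
  "hinge x = max 0 (1 - x)"

definition prefrank_obj :: "real \<Rightarrow> real mat \<Rightarrow> (nat \<times> nat \<Rightarrow> real) \<Rightarrow> (nat \<times> nat) set
    \<Rightarrow> real Matrix.vec \<Rightarrow> real" where
  "prefrank_obj C U y S w = 1/2 * scalar_prod w w
     + C * (\<Sum>p\<in>S. hinge (y p * scalar_prod w (kron_col U (fst p) (snd p))))"

definition is_prefrank_sol :: "real \<Rightarrow> real mat \<Rightarrow> (nat \<times> nat \<Rightarrow> real) \<Rightarrow> (nat \<times> nat) set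
    \<Rightarrow> real Matrix.vec \<Rightarrow> bool" where
  "is_prefrank_sol C U y S w \<longleftrightarrow> w \<in> carrier_vec (dim_row U * dim_row U)
     \<and> (\<forall>w' \<in> carrier_vec (dim_row U * dim_row U).
          prefrank_obj C U y S w \<le> prefrank_obj C U y S w')"

definition score :: "real mat \<Rightarrow> real Matrix.vec \<Rightarrow> nat \<times> nat \<Rightarrow> real" where
  "score U w p = scalar_prod w (kron_col U (fst p) (snd p))"

definition emp_err :: "(real \<Rightarrow> real \<Rightarrow> real) \<Rightarrow> (nat \<times> nat \<Rightarrow> real) \<Rightarrow> (nat \<times> nat \<Rightarrow> real)
    \<Rightarrow> (nat \<times> nat) set \<Rightarrow> real" where
  "emp_err l y g S = (\<Sum>p\<in>S. l (y p) (g p)) / real (card S)"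

end

theory Submission
  imports Defs "HOL-Probability.Hoeffding" "HOL-Combinatorics.Permutations"
begin

text \<open>
  Let \<open>Z S\<close> be the maximum of \<open>er(complement of S) - er(S)\<close> over the finitely many weight vectors
  that Pref-Rank can output. Replacing one sampled pair changes \<open>Z\<close> by at most \<open>B (1/m + 1/(N-m))\<close>,
  so revealing the sample one element at a time and applying Hoeffding's lemma at each step gives
  subgaussian concentration of \<open>Z\<close> around its mean.

  For the mean, write the difference of the two empirical errors as an average over matchings of
  \<open>k = min m (N-m)\<close> sampled pairs with unsampled ones. By Jensen it suffices to consider one matching;
  exchanging matched partners makes the terms symmetric, so independent signs may be inserted, and
  contraction together with the parallelogram law bounds the mean by \<open>2 \<Lambda> / (\<rho> sqrt k)\<close>, where \<open>\<Lambda>\<close>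
  bounds the norm of the output. Comparing the optimal \<open>w\<close> with \<open>(1-t) w\<close> and using
  \<open>\<parallel>(U \<otimes> U)\<^sup>T w\<parallel> \<le> \<lambda>\<^sub>1(K) \<parallel>w\<parallel>\<close> gives \<open>\<Lambda> = C \<lambda>\<^sub>1(K) sqrt m\<close>. As \<open>m \<le> 2k\<close> and
  \<open>sqrt (f (1-f)) \<le> 1/2\<close>, the mean is at most the second term of the bound, without any slack.
\<close>

subsection \<open>Sampling without replacement\<close>

definition avg :: "'a set \<Rightarrow> ('a \<Rightarrow> real) \<Rightarrow> real" where
  "avg A f = sum f A / real (card A)"

definition k_subsets :: "'a set \<Rightarrow> nat \<Rightarrow> 'a set set" where
  "k_subsets P m = {S. S \<subseteq> P \<and> card S = m}"

lemma avg_mono: "(\<And>x. x \<in> A \<Longrightarrow> f x \<le> g x) \<Longrightarrow> avg A f \<le> avg A g"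
  unfolding avg_def by (intro divide_right_mono sum_mono) auto

lemma avg_cong: "(\<And>x. x \<in> A \<Longrightarrow> f x = g x) \<Longrightarrow> avg A f = avg A g"
  unfolding avg_def by (metis sum.cong)

lemma avg_cmult: "avg A (\<lambda>x. c * f x) = c * avg A f"
  unfolding avg_def by (simp add: sum_distrib_left)

lemma finite_k_subsets [simp]: "finite P \<Longrightarrow> finite (k_subsets P m)"
  unfolding k_subsets_def by auto

lemma card_k_subsets: "finite P \<Longrightarrow> card (k_subsets P m) = card P choose m"
  unfolding k_subsets_def by (rule n_subsets)

lemma card_k_subsets_pos: "finite P \<Longrightarrow> m \<le> card P \<Longrightarrow> 0 < card (k_subsets P m)"
  by (simp add: card_k_subsets)

text \<open>Double counting of pairs of a set and a marked element: removing the marked element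
  \<open>a\<close> and inserting it again are inverse maps, and a set of size \<open>Suc m\<close>
  can be marked in \<open>Suc m\<close> ways.\<close>

lemma sum_k_subsets_Suc:
  assumes "finite P"
  shows "(\<Sum>a\<in>P. \<Sum>S\<in>k_subsets (P - {a}) m. F (insert a S))
           = real (Suc m) * (\<Sum>S\<in>k_subsets P (Suc m). F S)"
proof -
  have "(\<Sum>a\<in>P. \<Sum>S\<in>k_subsets (P - {a}) m. F (insert a S))
      = (\<Sum>(a, S)\<in>Sigma P (\<lambda>a. k_subsets (P - {a}) m). F (insert a S))"
    using assms by (simp add: sum.Sigma)
  also have "\<dots> = (\<Sum>(S, a)\<in>Sigma (k_subsets P (Suc m)) (\<lambda>S. S). F S)"
  proof (rule sum.reindex_bij_witness
      [where i = "\<lambda>(S, a). (a, S - {a})" and j = "\<lambda>(a, S). (insert a S, a)"])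
    fix x assume "x \<in> Sigma P (\<lambda>a. k_subsets (P - {a}) m)"
    then obtain a S where x: "x = (a, S)" "a \<in> P" "S \<subseteq> P - {a}" "card S = m"
      by (auto simp: k_subsets_def)
    moreover have "finite S" using x assms by (meson finite_Diff finite_subset)
    ultimately show "(case x of (a, S) \<Rightarrow> (insert a S, a)) \<in> Sigma (k_subsets P (Suc m)) (\<lambda>S. S)"
      by (auto simp: k_subsets_def card_insert_if)
  next
    fix y assume "y \<in> Sigma (k_subsets P (Suc m)) (\<lambda>S. S)"
    then obtain a S where y: "y = (S, a)" "a \<in> S" "S \<subseteq> P" "card S = Suc m"
      by (auto simp: k_subsets_def)
    moreover have "finite S" using y assms by (meson finite_subset)
    ultimately show "(case y of (S, a) \<Rightarrow> (a, S - {a})) \<in> Sigma P (\<lambda>a. k_subsets (P - {a}) m)"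
      by (auto simp: k_subsets_def)
  qed (auto simp: k_subsets_def)
  also have "\<dots> = (\<Sum>S\<in>k_subsets P (Suc m). \<Sum>a\<in>S. F S)"
    using assms by (subst sum.Sigma) (auto simp: k_subsets_def intro: finite_subset)
  also have "\<dots> = (\<Sum>S\<in>k_subsets P (Suc m). real (Suc m) * F S)"
    by (rule sum.cong) (auto simp: k_subsets_def)
  finally show ?thesis by (simp only: sum_distrib_left)
qed

text \<open>A uniform sample can be drawn as a uniform first element \<open>a\<close> followed by a
  uniform \<open>m\<close>-subset of \<open>P - {a}\<close>. This is the conditioning step on which
  the induction for the exponential moment rests.\<close>

lemma avg_k_subsets_Suc:
  assumes "finite P" "Suc m \<le> card P"
  shows "avg (k_subsets P (Suc m)) F = avg P (\<lambda>a. avg (k_subsets (P - {a}) m) (\<lambda>S. F (insert a S)))"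
proof -
  let ?c = "real ((card P - 1) choose m)"
  have P: "0 < card P" using assms by auto
  have "avg P (\<lambda>a. avg (k_subsets (P - {a}) m) (\<lambda>S. F (insert a S)))
      = (\<Sum>a\<in>P. (\<Sum>S\<in>k_subsets (P - {a}) m. F (insert a S)) / ?c) / real (card P)"
    unfolding avg_def using assms by (simp add: card_k_subsets)
  also have "\<dots> = real (Suc m) * (\<Sum>S\<in>k_subsets P (Suc m). F S) / (?c * real (card P))"
    unfolding sum_divide_distrib[symmetric] sum_k_subsets_Suc[OF assms(1)] by simp
  also have "?c * real (card P) = real (Suc m) * real (card P choose Suc m)"
    using Suc_times_binomial_eq[of "card P - 1" m] P
    by (metis Suc_diff_1 mult.commute of_nat_mult)
  finally show ?thesis
    unfolding avg_def using assms by (simp add: card_k_subsets)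
qed

section \<open>Exponential moments of set functions with bounded exchanges\<close>

definition swap_bounded :: "'a set \<Rightarrow> nat \<Rightarrow> real \<Rightarrow> ('a set \<Rightarrow> real) \<Rightarrow> bool" where
  "swap_bounded P m c Z \<longleftrightarrow>
     (\<forall>S\<in>k_subsets P m. \<forall>i\<in>S. \<forall>j\<in>P - S. \<bar>Z S - Z (insert j (S - {i}))\<bar> \<le> c)"

text \<open>Every exchange within \<open>P - {a}\<close> is an exchange for \<open>Z\<close> that
  leaves \<open>a\<close> in place, so the same constant \<open>c\<close> serves at each stage when
  the sample is revealed one element at a time.\<close>

lemma swap_bounded_insert:
  assumes "finite P" "swap_bounded P (Suc m) c Z" "a \<in> P"
  shows "swap_bounded (P - {a}) m c (\<lambda>S. Z (insert a S))"
  unfolding swap_bounded_def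
proof (intro ballI)
  fix S i j assume *: "S \<in> k_subsets (P - {a}) m" "i \<in> S" "j \<in> P - {a} - S"
  have "finite S" using * assms by (auto simp: k_subsets_def intro: finite_subset)
  then have 1: "insert a S \<in> k_subsets P (Suc m)"
    using * assms by (auto simp: k_subsets_def card_insert_if)
  have 2: "insert j (insert a S - {i}) = insert a (insert j (S - {i}))"
    using * by (auto simp: k_subsets_def)
  show "\<bar>Z (insert a S) - Z (insert a (insert j (S - {i})))\<bar> \<le> c"
    using assms(2) 1 * unfolding swap_bounded_def 2[symmetric] by auto
qed

lemma avg_diff_le_of_bij:
  assumes "bij_betw h A A'" "A \<noteq> {}" "finite A" "\<And>x. x \<in> A \<Longrightarrow> \<bar>f x - g (h x)\<bar> \<le> c"
  shows "\<bar>avg A f - avg A' g\<bar> \<le> c"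
proof -
  have "sum g A' = (\<Sum>x\<in>A. g (h x))"
    using sum.reindex_bij_betw[OF assms(1), of g] by simp
  then have "avg A f - avg A' g = (\<Sum>x\<in>A. f x - g (h x)) / real (card A)"
    unfolding avg_def using bij_betw_same_card[OF assms(1)]
    by (simp add: sum_subtractf diff_divide_distrib)
  also have "\<bar>\<dots>\<bar> \<le> (\<Sum>x\<in>A. \<bar>f x - g (h x)\<bar>) / real (card A)"
    unfolding abs_divide by (intro divide_mono sum_abs) (use assms in \<open>auto simp: card_gt_0_iff\<close>)
  also have "\<dots> \<le> (\<Sum>x\<in>A. c) / real (card A)"
    using assms(4) by (intro divide_right_mono sum_mono) auto
  also have "\<dots> = c" using assms by simp
  finally show ?thesis .
qed

text \<open>The two conditional laws are coupled by the bijection that puts \<open>a\<close> in the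
  place of \<open>b\<close> whenever \<open>b\<close> has been drawn. After \<open>a\<close> and
  \<open>b\<close> are added back, the coupled samples coincide if \<open>b\<close> was drawn and
  otherwise differ by one exchange.\<close>

lemma avg_insert_close:
  assumes "finite P" "Suc m \<le> card P" "swap_bounded P (Suc m) c Z" "0 \<le> c" "a \<in> P" "b \<in> P"
  shows "\<bar>avg (k_subsets (P - {a}) m) (\<lambda>S. Z (insert a S))
          - avg (k_subsets (P - {b}) m) (\<lambda>S. Z (insert b S))\<bar> \<le> c"
proof (cases "a = b")
  case False
  define h where "h a b S = (if b \<in> S then insert a (S - {b}) else S)" for a b and S :: "'a set"
  have h: "h a b S \<in> k_subsets (P - {b}) m" "h b a (h a b S) = S"
    if "S \<in> k_subsets (P - {a}) m" "a \<noteq> b" "a \<in> P" for a b S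
  proof -
    have "finite S" using that assms by (auto simp: k_subsets_def intro: finite_subset)
    moreover have "S \<noteq> {}" if "b \<in> S" using that by auto
    ultimately show "h a b S \<in> k_subsets (P - {b}) m" "h b a (h a b S) = S"
      using that by (auto simp: k_subsets_def h_def card_insert_if card_gt_0_iff)
  qed
  have bij: "bij_betw (h a b) (k_subsets (P - {a}) m) (k_subsets (P - {b}) m)"
    by (rule bij_betw_byWitness[where f' = "h b a"]) (use h False assms in auto)
  show ?thesis
  proof (rule avg_diff_le_of_bij[OF bij])
    have "0 < card (k_subsets (P - {a}) m)"
      using assms by (intro card_k_subsets_pos) auto
    then show "k_subsets (P - {a}) m \<noteq> {}" by auto
    show "finite (k_subsets (P - {a}) m)" using assms by auto
    fix S assume S: "S \<in> k_subsets (P - {a}) m"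
    have "finite S" using S assms by (auto simp: k_subsets_def intro: finite_subset)
    show "\<bar>Z (insert a S) - Z (insert b (h a b S))\<bar> \<le> c"
    proof (cases "b \<in> S")
      case True
      then have "insert b (h a b S) = insert a S" by (auto simp: h_def)
      then show ?thesis using assms by simp
    next
      case b: False
      have 1: "insert a S \<in> k_subsets P (Suc m)"
        using S assms \<open>finite S\<close> by (auto simp: k_subsets_def card_insert_if)
      have 2: "insert b (insert a S - {a}) = insert b S" using S by (auto simp: k_subsets_def)
      have "\<bar>Z (insert a S) - Z (insert b (insert a S - {a}))\<bar> \<le> c"
        using assms(3) 1 b False assms unfolding swap_bounded_def by blast
      then show ?thesis using b unfolding 2 h_def by simp
    qed
  qed
qed (use assms in simp)

lemma avg_exp_le_Hoeffding:
  assumes "finite A" "A \<noteq> {}" "0 < s" "\<And>a b. a \<in> A \<Longrightarrow> b \<in> A \<Longrightarrow> \<bar>f a - f b\<bar> \<le> c"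
  shows "avg A (\<lambda>x. exp (s * (f x - avg A f))) \<le> exp (s\<^sup>2 * c\<^sup>2 / 8)"
proof -
  \<comment> \<open>Starting the interval at the minimum turns the pairwise bound on differences
    into a range of length \<open>c\<close>, which is the form that Hoeffding's lemma takes.\<close>
  define lo where "lo = Min (f ` A)"
  have lo: "lo \<in> f ` A" "\<And>x. x \<in> A \<Longrightarrow> lo \<le> f x"
    unfolding lo_def using assms by (auto intro: Min_in)
  then have hi: "f x \<le> lo + c" if "x \<in> A" for x
    using assms(4)[of x] that by fastforce
  interpret interval_bounded_random_variable "measure_pmf (pmf_of_set A)" f lo "lo + c"
    by unfold_locales (use assms lo hi in \<open>auto simp: AE_measure_pmf_iff\<close>)
  have E: "measure_pmf.expectation (pmf_of_set A) g = avg A g" for g :: "'a \<Rightarrow> real"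
    unfolding avg_def by (rule integral_pmf_of_set) (use assms in auto)
  have "ennreal (avg A (\<lambda>x. exp (s * (f x - avg A f))))
      = nn_integral (measure_pmf (pmf_of_set A)) (\<lambda>x. ennreal (exp (s * (f x - avg A f))))"
    unfolding E[symmetric]
    by (rule nn_integral_eq_integral[symmetric])
      (auto intro!: integrable_measure_pmf_finite simp: assms)
  also have "\<dots> \<le> ennreal (exp (s\<^sup>2 * c\<^sup>2 / 8))"
    using Hoeffdings_lemma_nn_integral[OF assms(3)] by (simp add: E)
  finally show ?thesis by (simp add: ennreal_le_iff)
qed

text \<open>This is the martingale proof of a bounded-difference inequality, written as an induction
  on the number of draws. Given the first draw \<open>a\<close>, the induction hypothesis controls
  \<open>Z\<close> around its conditional mean \<open>M a\<close>; the conditional means lie within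
  \<open>c\<close> of each other, so Hoeffding's lemma adds one more factor
  \<open>exp (s\<^sup>2 * c\<^sup>2 / 8)\<close>. \<open>P\<close> and \<open>Z\<close> vary in the
  induction because each draw changes both.\<close>

lemma avg_exp_swap_bounded:
  assumes "finite P" "m \<le> card P" "swap_bounded P m c Z" "0 \<le> c" "0 < s"
  shows "avg (k_subsets P m) (\<lambda>S. exp (s * (Z S - avg (k_subsets P m) Z))) \<le> exp (s\<^sup>2 * (real m * c\<^sup>2) / 8)"
  using assms
proof (induction m arbitrary: P Z)
  case 0
  have "k_subsets P 0 = {{}}" using 0 by (auto simp: k_subsets_def card_eq_0_iff intro: finite_subset)
  then show ?case by (simp add: avg_def)
next
  case (Suc m)
  define M where "M a = avg (k_subsets (P - {a}) m) (\<lambda>S. Z (insert a S))" for a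
  let ?\<mu> = "avg (k_subsets P (Suc m)) Z"
  have \<mu>: "?\<mu> = avg P M" unfolding M_def using Suc.prems by (intro avg_k_subsets_Suc)
  have "avg (k_subsets P (Suc m)) (\<lambda>S. exp (s * (Z S - ?\<mu>)))
      = avg P (\<lambda>a. avg (k_subsets (P - {a}) m) (\<lambda>S. exp (s * (Z (insert a S) - ?\<mu>))))"
    using Suc.prems by (intro avg_k_subsets_Suc)
  also have "\<dots> \<le> avg P (\<lambda>a. exp (s\<^sup>2 * (real m * c\<^sup>2) / 8) * exp (s * (M a - avg P M)))"
  proof (rule avg_mono)
    fix a assume a: "a \<in> P"
    have "avg (k_subsets (P - {a}) m) (\<lambda>S. exp (s * (Z (insert a S) - ?\<mu>)))
       = avg (k_subsets (P - {a}) m) (\<lambda>S. exp (s * (M a - avg P M)) * exp (s * (Z (insert a S) - M a)))"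
      by (rule avg_cong) (simp add: \<mu> exp_add[symmetric] algebra_simps)
    also have "\<dots> = exp (s * (M a - avg P M)) *
        avg (k_subsets (P - {a}) m) (\<lambda>S. exp (s * (Z (insert a S) - M a)))"
      by (rule avg_cmult)
    also have "\<dots> \<le> exp (s * (M a - avg P M)) * exp (s\<^sup>2 * (real m * c\<^sup>2) / 8)"
    proof (intro mult_left_mono)
      show "avg (k_subsets (P - {a}) m) (\<lambda>S. exp (s * (Z (insert a S) - M a)))
          \<le> exp (s\<^sup>2 * (real m * c\<^sup>2) / 8)"
        unfolding M_def
        by (rule Suc.IH) (use Suc.prems a in \<open>auto intro: swap_bounded_insert\<close>)
    qed simp
    finally show "avg (k_subsets (P - {a}) m) (\<lambda>S. exp (s * (Z (insert a S) - ?\<mu>)))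
        \<le> exp (s\<^sup>2 * (real m * c\<^sup>2) / 8) * exp (s * (M a - avg P M))"
      by (simp add: mult.commute)
  qed
  also have "\<dots> \<le> exp (s\<^sup>2 * (real m * c\<^sup>2) / 8) * exp (s\<^sup>2 * c\<^sup>2 / 8)"
    unfolding avg_cmult
  proof (intro mult_left_mono avg_exp_le_Hoeffding)
    show "\<bar>M a - M b\<bar> \<le> c" if "a \<in> P" "b \<in> P" for a b
      unfolding M_def using that Suc.prems by (intro avg_insert_close)
  qed (use Suc.prems in auto)
  also have "\<dots> = exp (s\<^sup>2 * (real (Suc m) * c\<^sup>2) / 8)"
    by (simp add: exp_add[symmetric] algebra_simps add_divide_distrib)
  finally show ?case .
qed

lemma sampling_without_replacement_tail:
  assumes "finite P" "m \<le> card P" "swap_bounded P m c Z" "0 < c" "0 < m" "0 \<le> t"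
  shows "real (card {S \<in> k_subsets P m. avg (k_subsets P m) Z + t < Z S}) / real (card (k_subsets P m))
           \<le> exp (- 2 * t\<^sup>2 / (real m * c\<^sup>2))"
proof (cases "t = 0")
  case True
  have "card {S \<in> k_subsets P m. avg (k_subsets P m) Z + t < Z S} \<le> card (k_subsets P m)"
    using assms by (intro card_mono) auto
  then show ?thesis using True by (simp add: divide_le_eq)
next
  case False
  then have t: "0 < t" using assms by simp
  let ?A = "k_subsets P m" and ?\<mu> = "avg (k_subsets P m) Z"
  let ?V = "real m * c\<^sup>2"
  \<comment> \<open>This \<open>s\<close> minimises \<open>s\<^sup>2 * ?V / 8 - s * t\<close> and
    yields the exponent \<open>- 2 * t\<^sup>2 / ?V\<close>. It is positive only for
    \<open>t > 0\<close>, hence the separate trivial case \<open>t = 0\<close>.\<close>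
  define s where "s = 4 * t / ?V"
  have V: "0 < ?V" using assms by simp
  have s: "0 < s" unfolding s_def using t V by simp
  have "real (card {S \<in> ?A. ?\<mu> + t < Z S}) = (\<Sum>S\<in>{S \<in> ?A. ?\<mu> + t < Z S}. 1)" by simp
  also have "\<dots> \<le> (\<Sum>S\<in>{S \<in> ?A. ?\<mu> + t < Z S}. exp (s * (Z S - ?\<mu>) - s * t))"
    using s by (intro sum_mono) (auto simp: right_diff_distrib[symmetric] intro!: mult_nonneg_nonneg)
  also have "\<dots> \<le> (\<Sum>S\<in>?A. exp (s * (Z S - ?\<mu>) - s * t))"
    using assms by (intro sum_mono2) auto
  also have "\<dots> = exp (- (s * t)) * (\<Sum>S\<in>?A. exp (s * (Z S - ?\<mu>)))"
    by (simp add: sum_distrib_left exp_add[symmetric])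
  finally have "real (card {S \<in> ?A. ?\<mu> + t < Z S}) / real (card ?A)
      \<le> exp (- (s * t)) * avg ?A (\<lambda>S. exp (s * (Z S - ?\<mu>)))"
    unfolding avg_def by (simp add: divide_right_mono)
  also have "\<dots> \<le> exp (- (s * t)) * exp (s\<^sup>2 * ?V / 8)"
    using assms s by (intro mult_left_mono avg_exp_swap_bounded) auto
  also have "\<dots> = exp (- 2 * t\<^sup>2 / ?V)"
  proof -
    have "s\<^sup>2 * ?V / 8 - s * t = - 2 * t\<^sup>2 / ?V"
      unfolding s_def using V by (simp add: field_simps power2_eq_square)
    then show ?thesis by (simp add: exp_add[symmetric])
  qed
  finally show ?thesis .
qed

subsection \<open>Permutations and symmetrisation\<close>

text \<open>A uniform permutation carries a fixed set to a uniform sample and also records which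
  sampled element is matched with which unsampled one. Averages over permutations therefore allow
  individual partners to be exchanged.\<close>

definition perms :: "'a set \<Rightarrow> ('a \<Rightarrow> 'a) set" where
  "perms P = {\<pi>. \<pi> permutes P}"

lemma finite_perms [simp]: "finite P \<Longrightarrow> finite (perms P)"
  unfolding perms_def by (rule finite_permutations)

lemma id_in_perms: "id \<in> perms P"
  unfolding perms_def by (simp add: permutes_id)

lemma card_perms_pos: "finite P \<Longrightarrow> 0 < card (perms P)"
  using id_in_perms[of P] by (auto simp: card_gt_0_iff)

lemma avg_perms_compose:
  assumes "\<tau> permutes P"
  shows "avg (perms P) (\<lambda>\<pi>. F (\<pi> \<circ> \<tau>)) = avg (perms P) F"
  unfolding avg_def perms_def using sum_permutations_compose_right[OF assms, of F] by simp

text \<open>A bijection between the two sets is glued to one between their complements and extended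
  by the identity; this is transitivity of the symmetric group on sets of equal size.\<close>

lemma ex_permutes_image:
  assumes "finite P" "S \<in> k_subsets P m" "T \<in> k_subsets P m"
  shows "\<exists>\<tau>. \<tau> permutes P \<and> \<tau> ` S = T"
proof -
  have S: "S \<subseteq> P" "finite S" "T \<subseteq> P" "finite T" "card S = card T"
    using assms by (auto simp: k_subsets_def intro: finite_subset)
  then have "card (P - S) = card (P - T)" by (simp add: card_Diff_subset)
  then obtain f g where f: "bij_betw f S T" and g: "bij_betw g (P - S) (P - T)"
    using S assms(1) by (meson finite_same_card_bij finite_Diff)
  define h where "h x = (if x \<in> S then f x else if x \<in> P then g x else x)" for x
  have "bij_betw h S T" using f by (subst bij_betw_cong[where g = f]) (auto simp: h_def)
  moreover have "bij_betw h (P - S) (P - T)"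
    using g by (subst bij_betw_cong[where g = g]) (auto simp: h_def)
  ultimately have "bij_betw h (S \<union> (P - S)) (T \<union> (P - T))"
    by (rule bij_betw_combine) auto
  then have "bij_betw h P P" using S by (simp add: Un_absorb1)
  then have "h permutes P" by (rule bij_imp_permutes) (use S in \<open>auto simp: h_def\<close>)
  with \<open>bij_betw h S T\<close> show ?thesis by (auto simp: bij_betw_def)
qed

text \<open>Composing with a permutation that carries \<open>S0\<close> to \<open>S\<close> shows
  that the left side does not depend on the choice of \<open>S0\<close>. It may thus be averaged
  over all sets of size \<open>m\<close>, and for each single \<open>\<pi>\<close> the inner sum is
  merely reordered.\<close>

lemma avg_perms_image:
  assumes "finite P" "S0 \<in> k_subsets P m"
  shows "avg (perms P) (\<lambda>\<pi>. F (\<pi> ` S0)) = avg (k_subsets P m) F"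
proof -
  have 1: "avg (perms P) (\<lambda>\<pi>. F (\<pi> ` S)) = avg (perms P) (\<lambda>\<pi>. F (\<pi> ` S0))" if S: "S \<in> k_subsets P m" for S
  proof -
    obtain \<tau> where \<tau>: "\<tau> permutes P" "\<tau> ` S0 = S"
      using ex_permutes_image[OF assms S] by blast
    show ?thesis
      using avg_perms_compose[OF \<tau>(1), of "\<lambda>\<pi>. F (\<pi> ` S0)"]
      unfolding image_comp[symmetric] \<tau>(2) by this
  qed
  have 2: "(\<Sum>S\<in>k_subsets P m. F (\<pi> ` S)) = (\<Sum>S\<in>k_subsets P m. F S)" if "\<pi> \<in> perms P" for \<pi>
  proof (rule sum.reindex_bij_betw, rule bij_betw_byWitness[where f' = "image (inv_into UNIV \<pi>)"])
    have \<pi>: "\<pi> permutes P" using that by (simp add: perms_def)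
    then have inv: "inv_into UNIV \<pi> permutes P" by (rule permutes_inv)
    have *: "\<sigma> ` S \<in> k_subsets P m" if "\<sigma> permutes P" "S \<in> k_subsets P m" for \<sigma> S
      using that by (auto simp: k_subsets_def permutes_in_image card_image[OF permutes_inj_on])
    show "\<forall>S\<in>k_subsets P m. inv_into UNIV \<pi> ` \<pi> ` S = S" "\<forall>S\<in>k_subsets P m. \<pi> ` inv_into UNIV \<pi> ` S = S"
      using permutes_inverses[OF \<pi>] by (auto simp: image_image)
    show "image \<pi> ` k_subsets P m \<subseteq> k_subsets P m" "image (inv_into UNIV \<pi>) ` k_subsets P m \<subseteq> k_subsets P m"
      using *[OF \<pi>] *[OF inv] by auto
  qed
  have pos: "0 < card (k_subsets P m)" "0 < card (perms P)"
    using assms card_perms_pos by (auto simp: card_gt_0_iff)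
  have "real (card (k_subsets P m)) * avg (perms P) (\<lambda>\<pi>. F (\<pi> ` S0))
      = (\<Sum>S\<in>k_subsets P m. avg (perms P) (\<lambda>\<pi>. F (\<pi> ` S)))"
    by (simp add: 1)
  also have "\<dots> = (\<Sum>S\<in>k_subsets P m. \<Sum>\<pi>\<in>perms P. F (\<pi> ` S)) / real (card (perms P))"
    by (simp add: avg_def sum_divide_distrib)
  also have "\<dots> = (\<Sum>\<pi>\<in>perms P. \<Sum>S\<in>k_subsets P m. F (\<pi> ` S)) / real (card (perms P))"
    by (subst sum.swap) simp
  also have "\<dots> = (\<Sum>S\<in>k_subsets P m. F S)"
    using pos by (simp add: 2)
  finally show ?thesis using pos by (simp add: avg_def field_simps)
qed

text \<open>Composing with a transposition inside \<open>A\<close> shows that all points of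
  \<open>A\<close> have the same average under \<open>H\<close>; summing over \<open>A\<close> then
  only reorders a sum for each \<open>\<tau>\<close>. It is applied to one \<open>H\<close> twice,
  with \<open>A\<close> being the fixed sample and then its complement.\<close>

lemma avg_stabiliser:
  assumes "finite P" "A \<subseteq> P" "x \<in> A"
    and H: "H \<subseteq> perms P" "H \<noteq> {}" "\<And>\<tau>. \<tau> \<in> H \<Longrightarrow> \<tau> ` A = A"
      "\<And>\<tau> y z. \<tau> \<in> H \<Longrightarrow> y \<in> A \<Longrightarrow> z \<in> A \<Longrightarrow> \<tau> \<circ> Transposition.transpose y z \<in> H"
  shows "avg H (\<lambda>\<tau>. f (\<tau> x)) = avg A f"
proof -
  have fin: "finite H" "finite A" using assms by (auto intro: finite_subset)
  have 1: "(\<Sum>\<tau>\<in>H. f (\<tau> y)) = (\<Sum>\<tau>\<in>H. f (\<tau> x))" if "y \<in> A" for y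
    by (rule sum.reindex_bij_witness[where i = "\<lambda>\<tau>. \<tau> \<circ> Transposition.transpose x y" and j = "\<lambda>\<tau>. \<tau> \<circ> Transposition.transpose x y"])
      (use that assms in \<open>auto simp: o_assoc[symmetric]\<close>)
  have 2: "(\<Sum>y\<in>A. f (\<tau> y)) = (\<Sum>y\<in>A. f y)" if "\<tau> \<in> H" for \<tau>
  proof (rule sum.reindex_bij_betw)
    show "bij_betw \<tau> A A"
      using that H(1) H(3)[OF that] by (auto simp: bij_betw_def perms_def intro: permutes_inj_on)
  qed
  have "real (card A) * (\<Sum>\<tau>\<in>H. f (\<tau> x)) = (\<Sum>y\<in>A. \<Sum>\<tau>\<in>H. f (\<tau> y))"
    by (simp add: 1)
  also have "\<dots> = (\<Sum>\<tau>\<in>H. \<Sum>y\<in>A. f (\<tau> y))" by (rule sum.swap)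
  also have "\<dots> = real (card H) * (\<Sum>y\<in>A. f y)" by (simp add: 2)
  finally have "real (card A) * (\<Sum>\<tau>\<in>H. f (\<tau> x)) = real (card H) * (\<Sum>y\<in>A. f y)" .
  moreover have "card A > 0" "card H > 0" using fin assms by (auto simp: card_gt_0_iff)
  ultimately show ?thesis by (simp add: avg_def field_simps)
qed

section \<open>Maxima over a finite class and reduction to one matching\<close>

definition max_over :: "'w set \<Rightarrow> ('w \<Rightarrow> real) \<Rightarrow> real" where
  "max_over W f = Max (f ` W)"

lemma max_over_ge: "finite W \<Longrightarrow> w \<in> W \<Longrightarrow> f w \<le> max_over W f"
  unfolding max_over_def by simp

lemma max_over_le: "finite W \<Longrightarrow> W \<noteq> {} \<Longrightarrow> (\<And>w. w \<in> W \<Longrightarrow> f w \<le> c) \<Longrightarrow> max_over W f \<le> c"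
  unfolding max_over_def by simp

lemma max_over_attained: "finite W \<Longrightarrow> W \<noteq> {} \<Longrightarrow> \<exists>w\<in>W. max_over W f = f w"
  unfolding max_over_def using Max_in[of "f ` W"] by (simp add: image_iff)

text \<open>Jensen's inequality for the maximum, a convex function of the values.\<close>

lemma max_over_avg_le:
  assumes "finite W" "W \<noteq> {}"
  shows "max_over W (\<lambda>w. avg T (\<lambda>\<tau>. f \<tau> w)) \<le> avg T (\<lambda>\<tau>. max_over W (f \<tau>))"
  using assms by (intro max_over_le avg_mono max_over_ge)

lemma max_over_diff_le:
  assumes "finite W" "W \<noteq> {}" "\<And>w. w \<in> W \<Longrightarrow> \<bar>f w - g w\<bar> \<le> c"
  shows "\<bar>max_over W f - max_over W g\<bar> \<le> c"
proof -
  have "f w \<le> max_over W g + c" "g w \<le> max_over W f + c" if "w \<in> W" for w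
    using assms(3)[OF that] max_over_ge[OF assms(1) that, of f] max_over_ge[OF assms(1) that, of g] by auto
  then have "max_over W f \<le> max_over W g + c" "max_over W g \<le> max_over W f + c"
    using assms by (auto intro!: max_over_le)
  then show ?thesis by auto
qed

lemma avg_list_sum: "avg T (\<lambda>\<tau>. \<Sum>r\<leftarrow>rs. f r \<tau>) = (\<Sum>r\<leftarrow>rs. avg T (f r))"
  by (induction rs) (simp_all add: avg_def sum.distrib add_divide_distrib)

lemma avg_diff: "avg T (\<lambda>x. f x - g x) = avg T f - avg T g"
  unfolding avg_def by (simp add: sum_subtractf diff_divide_distrib)

text \<open>With the sample written as the image of \<open>S0\<close> under \<open>\<pi>\<close>,
  averaging over the setwise stabiliser \<open>H\<close> of \<open>S0\<close> turns the difference
  along each single pair into the full difference of the two averages. Jensen's inequality moves the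
  maximum inside, and the extra permutation from \<open>H\<close> is absorbed by
  \<open>\<pi>\<close> once the order of averaging is exchanged.\<close>

lemma avg_deviation_le_pairing:
  fixes g :: "'w \<Rightarrow> 'a \<Rightarrow> real"
  assumes "finite P" "S0 \<in> k_subsets P m" "finite W" "W \<noteq> {}"
    and rs: "\<And>r. r \<in> set rs \<Longrightarrow> fst r \<in> S0 \<and> snd r \<in> P - S0" "rs \<noteq> []"
  shows "avg (k_subsets P m) (\<lambda>S. max_over W (\<lambda>w. avg (P - S) (g w) - avg S (g w)))
      \<le> avg (perms P) (\<lambda>\<pi>. max_over W (\<lambda>w. \<Sum>r\<leftarrow>rs. (g w (\<pi> (snd r)) - g w (\<pi> (fst r))) / real (length rs)))"
proof -
  define H where "H = {\<tau>. \<tau> permutes P \<and> \<tau> ` S0 = S0}"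
  have S0: "S0 \<subseteq> P" using assms by (simp add: k_subsets_def)
  have H: "H \<subseteq> perms P" "id \<in> H" by (auto simp: H_def perms_def)
  then have "finite H" using assms by (auto intro: finite_subset)
  have fixS0: "\<tau> ` S0 = S0" if "\<tau> \<in> H" for \<tau> using that by (simp add: H_def)
  have comp: "\<tau> ` (P - S0) = P - S0" if "\<tau> \<in> H" for \<tau>
  proof -
    have "\<tau> ` (P - S0) = \<tau> ` P - \<tau> ` S0"
      using that by (intro image_set_diff) (auto simp: H_def permutes_inj)
    then show ?thesis using that by (simp add: H_def permutes_image)
  qed
  have swap: "\<tau> \<circ> Transposition.transpose y z \<in> H" if "\<tau> \<in> H" "y \<in> S0 \<and> z \<in> S0 \<or> y \<in> P - S0 \<and> z \<in> P - S0" for \<tau> y z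
  proof -
    have "Transposition.transpose y z permutes P" using that S0 by (intro permutes_swap_id) auto
    moreover have "Transposition.transpose y z ` S0 = S0"
      using that by (metis DiffD2 transpose_image_eq)
    ultimately show ?thesis
      using that unfolding H_def mem_Collect_eq image_comp[symmetric]
      by (simp only: permutes_compose)
  qed
  let ?\<Psi> = "\<lambda>\<pi> w. \<Sum>r\<leftarrow>rs. (g w (\<pi> (snd r)) - g w (\<pi> (fst r))) / real (length rs)"
  have "avg (k_subsets P m) (\<lambda>S. max_over W (\<lambda>w. avg (P - S) (g w) - avg S (g w)))
      = avg (perms P) (\<lambda>\<pi>. max_over W (\<lambda>w. avg (P - \<pi> ` S0) (g w) - avg (\<pi> ` S0) (g w)))"
    using assms(1,2) by (rule avg_perms_image[symmetric])
  also have "\<dots> \<le> avg (perms P) (\<lambda>\<pi>. avg H (\<lambda>\<tau>. max_over W (?\<Psi> (\<pi> \<circ> \<tau>))))"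
  proof (rule avg_mono)
    fix \<pi> assume "\<pi> \<in> perms P"
    then have \<pi>: "\<pi> permutes P" by (simp add: perms_def)
    have im: "avg (\<pi> ` A) f = avg A (f \<circ> \<pi>)" if "A \<subseteq> P" for A and f :: "'a \<Rightarrow> real"
      unfolding avg_def
      using permutes_inj_on[OF \<pi>] by (simp add: sum.reindex card_image)
    have co: "P - \<pi> ` S0 = \<pi> ` (P - S0)"
      using permutes_inj[OF \<pi>] permutes_image[OF \<pi>] by (metis image_set_diff)
    have a: "avg H (\<lambda>\<tau>. (f \<circ> \<pi>) (\<tau> x)) = avg S0 (f \<circ> \<pi>)" if "x \<in> S0" for x and f :: "'a \<Rightarrow> real"
      by (rule avg_stabiliser[where P = P]) (use that H S0 assms(1) swap fixS0 in auto)
    have b: "avg H (\<lambda>\<tau>. (f \<circ> \<pi>) (\<tau> x)) = avg (P - S0) (f \<circ> \<pi>)" if "x \<in> P - S0" for x and f :: "'a \<Rightarrow> real"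
      by (rule avg_stabiliser[where P = P]) (use that H assms(1) swap comp in auto)
    have "avg (P - \<pi> ` S0) (g w) - avg (\<pi> ` S0) (g w) = avg H (\<lambda>\<tau>. ?\<Psi> (\<pi> \<circ> \<tau>) w)" for w
    proof -
      have "avg H (\<lambda>\<tau>. ?\<Psi> (\<pi> \<circ> \<tau>) w)
          = (\<Sum>r\<leftarrow>rs. avg H (\<lambda>\<tau>. (1 / real (length rs)) * ((g w \<circ> \<pi>) (\<tau> (snd r)) - (g w \<circ> \<pi>) (\<tau> (fst r)))))"
        by (simp add: avg_list_sum)
      also have "\<dots> = (\<Sum>r\<leftarrow>rs. (avg (P - S0) (g w \<circ> \<pi>) - avg S0 (g w \<circ> \<pi>)) / real (length rs))"
      proof (intro arg_cong[where f = sum_list] map_cong refl)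
        fix r assume "r \<in> set rs"
        then have "fst r \<in> S0" "snd r \<in> P - S0" using rs by auto
        then show "avg H (\<lambda>\<tau>. (1 / real (length rs)) * ((g w \<circ> \<pi>) (\<tau> (snd r)) - (g w \<circ> \<pi>) (\<tau> (fst r))))
            = (avg (P - S0) (g w \<circ> \<pi>) - avg S0 (g w \<circ> \<pi>)) / real (length rs)"
          unfolding avg_cmult avg_diff by (simp only: a b) simp
      qed
      also have "\<dots> = avg (P - S0) (g w \<circ> \<pi>) - avg S0 (g w \<circ> \<pi>)"
        using rs(2) by (simp add: sum_list_triv)
      finally show ?thesis using S0 by (simp add: co im)
    qed
    then show "max_over W (\<lambda>w. avg (P - \<pi> ` S0) (g w) - avg (\<pi> ` S0) (g w))
        \<le> avg H (\<lambda>\<tau>. max_over W (?\<Psi> (\<pi> \<circ> \<tau>)))"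
      using max_over_avg_le[OF assms(3,4), of H "\<lambda>\<tau>. ?\<Psi> (\<pi> \<circ> \<tau>)"] by simp
  qed
  also have "\<dots> = avg H (\<lambda>\<tau>. avg (perms P) (\<lambda>\<pi>. max_over W (?\<Psi> (\<pi> \<circ> \<tau>))))"
    unfolding avg_def by (simp add: sum_divide_distrib[symmetric] divide_divide_eq_left mult.commute sum.swap[of _ H])
  also have "\<dots> = avg H (\<lambda>\<tau>. avg (perms P) (\<lambda>\<pi>. max_over W (?\<Psi> \<pi>)))"
  proof (rule avg_cong)
    fix \<tau> assume "\<tau> \<in> H"
    then have \<tau>: "\<tau> permutes P" by (simp add: H_def)
    show "avg (perms P) (\<lambda>\<pi>. max_over W (?\<Psi> (\<pi> \<circ> \<tau>))) = avg (perms P) (\<lambda>\<pi>. max_over W (?\<Psi> \<pi>))"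
      by (rule avg_perms_compose[OF \<tau>])
  qed
  also have "\<dots> = avg (perms P) (\<lambda>\<pi>. max_over W (?\<Psi> \<pi>))"
    using \<open>finite H\<close> H(2) unfolding avg_def[of H] by auto
  finally show ?thesis .
qed

text \<open>The average over all signs \<open>e\<close> of \<open>max_over W (H + \<Sum> e\<^sub>i h\<^sub>i)\<close>.\<close>
fun rademacher :: "'w set \<Rightarrow> ('w \<Rightarrow> real) list \<Rightarrow> ('w \<Rightarrow> real) \<Rightarrow> real" where
  "rademacher W [] H = max_over W H"
| "rademacher W (h # hs) H = (rademacher W hs (\<lambda>w. H w + h w) + rademacher W hs (\<lambda>w. H w - h w)) / 2"

text \<open>Exchanging the images of the two members of a pair flips the sign of that pair's
  difference and leaves the rest unchanged, since the pairs are disjoint. The average thus equals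
  the mean of its two signed versions. The term \<open>X\<close> collects the pairs that already
  carry signs; it must be general for the induction and stay invariant under the exchanges still to
  come.\<close>

lemma avg_perms_symmetrise:
  fixes g :: "'w \<Rightarrow> 'a \<Rightarrow> real"
  assumes "finite P" "distinct (map fst rs @ map snd rs)" "set (map fst rs @ map snd rs) \<subseteq> P"
    and "\<And>r \<pi> w. r \<in> set rs \<Longrightarrow> X (\<pi> \<circ> Transposition.transpose (fst r) (snd r)) w = X \<pi> w"
  shows "avg (perms P) (\<lambda>\<pi>. max_over W (\<lambda>w. X \<pi> w + (\<Sum>r\<leftarrow>rs. g w (\<pi> (snd r)) - g w (\<pi> (fst r)))))
       = avg (perms P) (\<lambda>\<pi>. rademacher W (map (\<lambda>r w. g w (\<pi> (snd r)) - g w (\<pi> (fst r))) rs) (X \<pi>))"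
  using assms
proof (induction rs arbitrary: X)
  case Nil
  then show ?case by simp
next
  case (Cons r rs)
  let ?d = "\<lambda>\<pi> r w. g w (\<pi> (snd r)) - g w (\<pi> (fst r))"
  let ?\<tau> = "Transposition.transpose (fst r) (snd r)"
  let ?E = "avg (perms P)"
  have off: "?\<tau> x = x" if "x \<in> set (map fst rs @ map snd rs)" for x
    using that Cons.prems(2) by (intro transpose_apply_other) auto
  have off': "Transposition.transpose (fst s) (snd s) x = x" if "s \<in> set rs" "x = fst r \<or> x = snd r" for s x
    using that Cons.prems(2) by (intro transpose_apply_other) (auto intro: rev_image_eqI)
  have swap: "X (\<pi> \<circ> ?\<tau>) w = X \<pi> w" for \<pi> w 
    by (rule Cons.prems(4)) simp
  have plus: "?E (\<lambda>\<pi>. max_over W (\<lambda>w. (X \<pi> w + ?d \<pi> r w) + (\<Sum>s\<leftarrow>rs. ?d \<pi> s w)))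
      = ?E (\<lambda>\<pi>. rademacher W (map (?d \<pi>) rs) (\<lambda>w. X \<pi> w + ?d \<pi> r w))"
    by (rule Cons.IH) (use Cons.prems off' in auto)
  have minus: "?E (\<lambda>\<pi>. max_over W (\<lambda>w. (X \<pi> w - ?d \<pi> r w) + (\<Sum>s\<leftarrow>rs. ?d \<pi> s w)))
      = ?E (\<lambda>\<pi>. rademacher W (map (?d \<pi>) rs) (\<lambda>w. X \<pi> w - ?d \<pi> r w))"
    by (rule Cons.IH) (use Cons.prems off' in auto)
  have perm: "?\<tau> permutes P" using Cons.prems by (intro permutes_swap_id) auto
  have rest: "(\<Sum>s\<leftarrow>rs. ?d (\<pi> \<circ> ?\<tau>) s w) = (\<Sum>s\<leftarrow>rs. ?d \<pi> s w)" for \<pi> w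
    using off by (intro arg_cong[where f = sum_list] map_cong refl) auto
  have "?E (\<lambda>\<pi>. max_over W (\<lambda>w. (X \<pi> w - ?d \<pi> r w) + (\<Sum>s\<leftarrow>rs. ?d \<pi> s w)))
      = ?E (\<lambda>\<pi>. max_over W (\<lambda>w. (X (\<pi> \<circ> ?\<tau>) w - ?d (\<pi> \<circ> ?\<tau>) r w) + (\<Sum>s\<leftarrow>rs. ?d (\<pi> \<circ> ?\<tau>) s w)))"
    by (rule avg_perms_compose[OF perm, symmetric])
  also have "\<dots> = ?E (\<lambda>\<pi>. max_over W (\<lambda>w. (X \<pi> w + ?d \<pi> r w) + (\<Sum>s\<leftarrow>rs. ?d \<pi> s w)))"
    unfolding swap rest by (simp add: algebra_simps)
  finally have eq: "?E (\<lambda>\<pi>. max_over W (\<lambda>w. (X \<pi> w - ?d \<pi> r w) + (\<Sum>s\<leftarrow>rs. ?d \<pi> s w)))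
      = ?E (\<lambda>\<pi>. max_over W (\<lambda>w. (X \<pi> w + ?d \<pi> r w) + (\<Sum>s\<leftarrow>rs. ?d \<pi> s w)))" .
  have half: "?E (\<lambda>\<pi>. (a \<pi> + b \<pi>) / 2) = (?E a + ?E b) / 2" for a b :: "('a \<Rightarrow> 'a) \<Rightarrow> real"
    by (simp add: avg_def sum.distrib sum_divide_distrib[symmetric] add_divide_distrib)
  show ?case
    unfolding list.map rademacher.simps half plus[symmetric] minus[symmetric] eq
    by (simp add: add.assoc)
qed

text \<open>One step of a contraction principle in which two functionals \<open>p\<close> and
  \<open>q\<close> together control \<open>d\<close>. If \<open>a\<close> and \<open>b\<close>
  attain the two maxima on the left, the sum is \<open>H a + H b + d a - d b\<close>. The factor 2
  on the right is offset by averaging, so that \<open>p\<close> and \<open>q\<close> end up in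
  separate sign averages.\<close>

lemma max_over_contract:
  assumes "finite W" "W \<noteq> {}"
    and "\<And>w w'. w \<in> W \<Longrightarrow> w' \<in> W \<Longrightarrow> \<bar>d w - d w'\<bar> \<le> \<bar>p w - p w'\<bar> + \<bar>q w - q w'\<bar>"
  shows "max_over W (\<lambda>w. H w + d w) + max_over W (\<lambda>w. H w - d w)
     \<le> (max_over W (\<lambda>w. H w + 2 * p w) + max_over W (\<lambda>w. H w - 2 * p w)
        + max_over W (\<lambda>w. H w + 2 * q w) + max_over W (\<lambda>w. H w - 2 * q w)) / 2"
proof -
  obtain a where a: "a \<in> W" "max_over W (\<lambda>w. H w + d w) = H a + d a"
    using max_over_attained[OF assms(1,2)] by blast
  obtain b where b: "b \<in> W" "max_over W (\<lambda>w. H w - d w) = H b - d b"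
    using max_over_attained[OF assms(1,2)] by blast
  have *: "H a + H b + 2 * \<bar>f a - f b\<bar> \<le> max_over W (\<lambda>w. H w + 2 * f w) + max_over W (\<lambda>w. H w - 2 * f w)" for f
    using max_over_ge[OF assms(1) a(1), of "\<lambda>w. H w + 2 * f w"] max_over_ge[OF assms(1) b(1), of "\<lambda>w. H w + 2 * f w"]
      max_over_ge[OF assms(1) a(1), of "\<lambda>w. H w - 2 * f w"] max_over_ge[OF assms(1) b(1), of "\<lambda>w. H w - 2 * f w"]
    by (auto simp: abs_if)
  show ?thesis using *[of p] *[of q] assms(3)[OF a(1) b(1)] a(2) b(2) by argo
qed

text \<open>The remaining signs only shift \<open>H\<close>, so the inequality for maxima holds for
  each choice of them and survives averaging.\<close>

lemma rademacher_contract: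
  assumes "finite W" "W \<noteq> {}"
    and "\<And>w w'. w \<in> W \<Longrightarrow> w' \<in> W \<Longrightarrow> \<bar>d w - d w'\<bar> \<le> \<bar>p w - p w'\<bar> + \<bar>q w - q w'\<bar>"
  shows "rademacher W hs (\<lambda>w. H w + d w) + rademacher W hs (\<lambda>w. H w - d w)
     \<le> (rademacher W hs (\<lambda>w. H w + 2 * p w) + rademacher W hs (\<lambda>w. H w - 2 * p w)
        + rademacher W hs (\<lambda>w. H w + 2 * q w) + rademacher W hs (\<lambda>w. H w - 2 * q w)) / 2"
proof (induction hs arbitrary: H)
  case Nil
  show ?case using max_over_contract[of W d p q H] assms by simp
next
  case (Cons h hs)
  have eqs: "H w + e + h w = (H w + h w) + e" "H w + e - h w = (H w - h w) + e"
    "H w - e + h w = (H w + h w) - e" "H w - e - h w = (H w - h w) - e" for w e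
    by auto
  show ?case
    using Cons.IH[of "\<lambda>w. H w + h w"] Cons.IH[of "\<lambda>w. H w - h w"]
    unfolding rademacher.simps eqs by argo
qed

subsection \<open>Rademacher averages of linear functionals\<close>

abbreviation dot :: "real Matrix.vec \<Rightarrow> real Matrix.vec \<Rightarrow> real" (infixl "\<bullet>\<^sub>v" 70) where
  "v \<bullet>\<^sub>v w \<equiv> scalar_prod v w"

lemma dot_eq_sum: "w \<in> carrier_vec n \<Longrightarrow> v \<bullet>\<^sub>v w = (\<Sum>i<n. vec_index v i * vec_index w i)"
  unfolding scalar_prod_def by (simp add: lessThan_atLeast0)

lemma dot_self_nonneg: "0 \<le> v \<bullet>\<^sub>v v"
  unfolding scalar_prod_def by (intro sum_nonneg) simp

lemma dot_self_pos:
  assumes "v \<in> carrier_vec n" "v \<noteq> 0\<^sub>v n"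
  shows "0 < v \<bullet>\<^sub>v v"
proof -
  obtain i where i: "i < n" "vec_index v i \<noteq> 0"
    using assms by (metis carrier_vecD eq_vecI index_zero_vec)
  then have "0 < (vec_index v i) * (vec_index v i)" by (simp add: zero_less_mult_iff) linarith
  also have "\<dots> \<le> (\<Sum>i<n. vec_index v i * vec_index v i)"
    using i by (intro member_le_sum) auto
  finally show ?thesis using assms(1) by (simp add: dot_eq_sum)
qed

lemma dot_Cauchy_Schwarz:
  assumes "v \<in> carrier_vec n" "w \<in> carrier_vec n"
  shows "(v \<bullet>\<^sub>v w)\<^sup>2 \<le> (v \<bullet>\<^sub>v v) * (w \<bullet>\<^sub>v w)"
  using Cauchy_Schwarz_ineq_sum[of "\<lambda>i. vec_index v i" "\<lambda>i. vec_index w i" "{..<n}"] assms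
  by (simp add: dot_eq_sum power2_eq_square)

lemma dot_parallelogram:
  assumes "x \<in> carrier_vec n" "v \<in> carrier_vec n"
  shows "(x + v) \<bullet>\<^sub>v (x + v) + (x - v) \<bullet>\<^sub>v (x - v) = 2 * (x \<bullet>\<^sub>v x) + 2 * (v \<bullet>\<^sub>v v)"
  using assms
  by (simp add: dot_eq_sum[of _ n] sum_distrib_left sum.distrib[symmetric] algebra_simps
      minus_add_uminus_vec)

lemma sqrt_add_le:
  assumes "0 \<le> a" "0 \<le> b"
  shows "sqrt a + sqrt b \<le> 2 * sqrt ((a + b) / 2)"
proof (rule power2_le_imp_le)
  have "0 \<le> (sqrt a - sqrt b)\<^sup>2" by simp
  then show "(sqrt a + sqrt b)\<^sup>2 \<le> (2 * sqrt ((a + b) / 2))\<^sup>2"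
    using assms by (simp add: power2_sum power2_diff power_mult_distrib)
qed (use assms in auto)

lemma rademacher_cong:
  assumes "\<And>w. w \<in> W \<Longrightarrow> H w = H' w"
  shows "rademacher W hs H = rademacher W hs H'"
  using assms
proof (induction hs arbitrary: H H')
  case Nil
  then show ?case by (simp add: max_over_def cong: image_cong)
next
  case (Cons h hs)
  have "rademacher W hs (\<lambda>w. H w + h w) = rademacher W hs (\<lambda>w. H' w + h w)"
    "rademacher W hs (\<lambda>w. H w - h w) = rademacher W hs (\<lambda>w. H' w - h w)"
    by (rule Cons.IH, simp add: Cons.prems)+
  then show ?case by simp
qed

lemma max_over_dot_le:
  assumes "finite W" "W \<noteq> {}" "W \<subseteq> carrier_vec D" "\<And>w. w \<in> W \<Longrightarrow> w \<bullet>\<^sub>v w \<le> \<Lambda>\<^sup>2" "0 \<le> \<Lambda>"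
    and "x \<in> carrier_vec D"
  shows "max_over W (\<lambda>w. w \<bullet>\<^sub>v x) \<le> \<Lambda> * sqrt (x \<bullet>\<^sub>v x)"
proof (rule max_over_le)
  fix w assume w: "w \<in> W"
  have "(w \<bullet>\<^sub>v x)\<^sup>2 \<le> (w \<bullet>\<^sub>v w) * (x \<bullet>\<^sub>v x)"
    using w assms by (intro dot_Cauchy_Schwarz[of _ D]) auto
  also have "\<dots> \<le> \<Lambda>\<^sup>2 * (x \<bullet>\<^sub>v x)"
    using w assms dot_self_nonneg by (intro mult_right_mono) auto
  also have "\<dots> = (\<Lambda> * sqrt (x \<bullet>\<^sub>v x))\<^sup>2"
    by (simp add: power_mult_distrib dot_self_nonneg)
  finally show "w \<bullet>\<^sub>v x \<le> \<Lambda> * sqrt (x \<bullet>\<^sub>v x)"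
    by (rule power2_le_imp_le) (simp add: assms dot_self_nonneg)
qed (use assms in auto)

text \<open>Each term \<open>d\<close> is exchanged by contraction for signed multiples of
  \<open>a\<close> and \<open>b\<close>, which are linear in \<open>w\<close> and can be merged into
  the vector \<open>x\<close>. By the parallelogram law a shift by \<open>v\<close> with both signs
  raises the mean squared norm by \<open>v \<bullet>\<^sub>v v\<close>, at most
  \<open>4 * L\<^sup>2\<close>, and concavity of the square root finishes the step. For the empty
  list Cauchy-Schwarz remains.\<close>

lemma rademacher_dot_le:
  assumes W: "finite W" "W \<noteq> {}" "W \<subseteq> carrier_vec D" "\<And>w. w \<in> W \<Longrightarrow> w \<bullet>\<^sub>v w \<le> \<Lambda>\<^sup>2" "0 \<le> \<Lambda>" "0 \<le> L"
    and "\<And>d. d \<in> set ds \<Longrightarrow> \<exists>a\<in>carrier_vec D. \<exists>b\<in>carrier_vec D. a \<bullet>\<^sub>v a \<le> 1 \<and> b \<bullet>\<^sub>v b \<le> 1 \<and>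
          (\<forall>w\<in>W. \<forall>w'\<in>W. \<bar>d w - d w'\<bar> \<le> L * \<bar>w \<bullet>\<^sub>v a - w' \<bullet>\<^sub>v a\<bar> + L * \<bar>w \<bullet>\<^sub>v b - w' \<bullet>\<^sub>v b\<bar>)"
    and "x \<in> carrier_vec D"
  shows "rademacher W ds (\<lambda>w. w \<bullet>\<^sub>v x) \<le> \<Lambda> * sqrt (x \<bullet>\<^sub>v x + 4 * L\<^sup>2 * real (length ds))"
  using assms(7,8)
proof (induction ds arbitrary: x)
  case Nil
  then show ?case using max_over_dot_le[OF W(1-5)] by simp
next
  case (Cons d ds)
  let ?s = "4 * L\<^sup>2 * real (length ds)"
  obtain a b where ab: "a \<in> carrier_vec D" "b \<in> carrier_vec D" "a \<bullet>\<^sub>v a \<le> 1" "b \<bullet>\<^sub>v b \<le> 1"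
    and d: "\<And>w w'. w \<in> W \<Longrightarrow> w' \<in> W \<Longrightarrow>
      \<bar>d w - d w'\<bar> \<le> L * \<bar>w \<bullet>\<^sub>v a - w' \<bullet>\<^sub>v a\<bar> + L * \<bar>w \<bullet>\<^sub>v b - w' \<bullet>\<^sub>v b\<bar>"
    using Cons.prems(1)[of d] by auto
  have step: "rademacher W ds (\<lambda>w. w \<bullet>\<^sub>v x + 2 * (L * (w \<bullet>\<^sub>v c))) + rademacher W ds (\<lambda>w. w \<bullet>\<^sub>v x - 2 * (L * (w \<bullet>\<^sub>v c)))
      \<le> 2 * (\<Lambda> * sqrt (x \<bullet>\<^sub>v x + 4 * L\<^sup>2 * real (length (d # ds))))"
    if c: "c \<in> carrier_vec D" "c \<bullet>\<^sub>v c \<le> 1" for c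
  proof -
    define v where "v = (2 * L) \<cdot>\<^sub>v c"
    have v: "v \<in> carrier_vec D" unfolding v_def using c by simp
    have vv: "v \<bullet>\<^sub>v v \<le> 4 * L\<^sup>2"
      unfolding v_def using c mult_left_mono[of "c \<bullet>\<^sub>v c" 1 "4 * L\<^sup>2"]
      by (simp add: scalar_prod_smult_distrib[of _ D] smult_scalar_prod_distrib[of _ D] power2_eq_square)
    have wv: "w \<bullet>\<^sub>v v = 2 * (L * (w \<bullet>\<^sub>v c))" if "w \<in> W" for w
      unfolding v_def using that W(3) c by (subst scalar_prod_smult_distrib[of _ D]) auto
    have "rademacher W ds (\<lambda>w. w \<bullet>\<^sub>v x + 2 * (L * (w \<bullet>\<^sub>v c))) = rademacher W ds (\<lambda>w. w \<bullet>\<^sub>v (x + v))"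
      using W(3) v Cons.prems(2)
      by (intro rademacher_cong) (auto simp: wv scalar_prod_add_distrib[of _ D])
    also have "\<dots> \<le> \<Lambda> * sqrt ((x + v) \<bullet>\<^sub>v (x + v) + ?s)"
      using Cons.prems v by (intro Cons.IH) auto
    finally have 1: "rademacher W ds (\<lambda>w. w \<bullet>\<^sub>v x + 2 * (L * (w \<bullet>\<^sub>v c))) \<le> \<Lambda> * sqrt ((x + v) \<bullet>\<^sub>v (x + v) + ?s)" .
    have "rademacher W ds (\<lambda>w. w \<bullet>\<^sub>v x - 2 * (L * (w \<bullet>\<^sub>v c))) = rademacher W ds (\<lambda>w. w \<bullet>\<^sub>v (x - v))"
      using W(3) v Cons.prems(2)
      by (intro rademacher_cong) (auto simp: wv scalar_prod_minus_distrib[of _ D])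
    also have "\<dots> \<le> \<Lambda> * sqrt ((x - v) \<bullet>\<^sub>v (x - v) + ?s)"
      using Cons.prems v by (intro Cons.IH) auto
    finally have 2: "rademacher W ds (\<lambda>w. w \<bullet>\<^sub>v x - 2 * (L * (w \<bullet>\<^sub>v c))) \<le> \<Lambda> * sqrt ((x - v) \<bullet>\<^sub>v (x - v) + ?s)" .
    have "sqrt ((x + v) \<bullet>\<^sub>v (x + v) + ?s) + sqrt ((x - v) \<bullet>\<^sub>v (x - v) + ?s)
        \<le> 2 * sqrt (((x + v) \<bullet>\<^sub>v (x + v) + ?s + ((x - v) \<bullet>\<^sub>v (x - v) + ?s)) / 2)"
      by (intro sqrt_add_le add_nonneg_nonneg dot_self_nonneg) auto
    also have "((x + v) \<bullet>\<^sub>v (x + v) + ?s + ((x - v) \<bullet>\<^sub>v (x - v) + ?s)) / 2 = x \<bullet>\<^sub>v x + v \<bullet>\<^sub>v v + ?s"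
      using dot_parallelogram[OF Cons.prems(2) v] by simp
    also have "sqrt (x \<bullet>\<^sub>v x + v \<bullet>\<^sub>v v + ?s) \<le> sqrt (x \<bullet>\<^sub>v x + 4 * L\<^sup>2 * real (length (d # ds)))"
      using vv by (simp add: algebra_simps)
    finally have "\<Lambda> * (sqrt ((x + v) \<bullet>\<^sub>v (x + v) + ?s) + sqrt ((x - v) \<bullet>\<^sub>v (x - v) + ?s))
        \<le> \<Lambda> * (2 * sqrt (x \<bullet>\<^sub>v x + 4 * L\<^sup>2 * real (length (d # ds))))"
      using W(5) by (intro mult_left_mono) auto
    then show ?thesis using 1 2 unfolding distrib_left by linarith
  qed
  have d': "\<bar>d w - d w'\<bar> \<le> \<bar>L * (w \<bullet>\<^sub>v a) - L * (w' \<bullet>\<^sub>v a)\<bar> + \<bar>L * (w \<bullet>\<^sub>v b) - L * (w' \<bullet>\<^sub>v b)\<bar>"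
    if "w \<in> W" "w' \<in> W" for w w'
    using d[OF that] W(6) by (simp add: right_diff_distrib[symmetric] abs_mult)
  have "rademacher W ds (\<lambda>w. w \<bullet>\<^sub>v x + d w) + rademacher W ds (\<lambda>w. w \<bullet>\<^sub>v x - d w)
     \<le> (rademacher W ds (\<lambda>w. w \<bullet>\<^sub>v x + 2 * (L * (w \<bullet>\<^sub>v a))) + rademacher W ds (\<lambda>w. w \<bullet>\<^sub>v x - 2 * (L * (w \<bullet>\<^sub>v a)))
        + rademacher W ds (\<lambda>w. w \<bullet>\<^sub>v x + 2 * (L * (w \<bullet>\<^sub>v b))) + rademacher W ds (\<lambda>w. w \<bullet>\<^sub>v x - 2 * (L * (w \<bullet>\<^sub>v b)))) / 2"
    by (rule rademacher_contract[OF W(1,2)]) (rule d')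
  then show ?case
    using step[OF ab(1,3)] step[OF ab(2,4)]
    unfolding rademacher.simps by argo
qed

text \<open>The bounds \<open>k \<le> m\<close> and \<open>m + k \<le> card P\<close> leave room to
  match \<open>k\<close> sampled elements with \<open>k\<close> unsampled ones. Each pair
  difference, divided by \<open>k\<close>, is Lipschitz with constant \<open>L / k\<close> in two
  feature products, so the \<open>k\<close> terms contribute
  \<open>4 * (L / k)\<^sup>2 * k = (2 * L)\<^sup>2 / k\<close> under the root.\<close>

lemma expected_deviation_le:
  fixes g :: "real Matrix.vec \<Rightarrow> 'a \<Rightarrow> real"
  assumes "finite P" "0 < k" "k \<le> m" "m + k \<le> card P"
    and W: "finite W" "W \<noteq> {}" "W \<subseteq> carrier_vec D" "\<And>w. w \<in> W \<Longrightarrow> w \<bullet>\<^sub>v w \<le> \<Lambda>\<^sup>2" "0 \<le> \<Lambda>" "0 \<le> L"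
    and v: "\<And>p. p \<in> P \<Longrightarrow> v p \<in> carrier_vec D \<and> v p \<bullet>\<^sub>v v p \<le> 1"
    and g: "\<And>p w w'. p \<in> P \<Longrightarrow> w \<in> W \<Longrightarrow> w' \<in> W \<Longrightarrow> \<bar>g w p - g w' p\<bar> \<le> L * \<bar>w \<bullet>\<^sub>v v p - w' \<bullet>\<^sub>v v p\<bar>"
  shows "avg (k_subsets P m) (\<lambda>S. max_over W (\<lambda>w. avg (P - S) (g w) - avg S (g w))) \<le> 2 * L * \<Lambda> / sqrt (real k)"
proof -
  have "0 < card (k_subsets P m)" using assms by (intro card_k_subsets_pos) auto
  then obtain S0 where S0: "S0 \<in> k_subsets P m" by (metis card.empty less_irrefl ex_in_conv)
  then have S0': "S0 \<subseteq> P" "card S0 = m" "finite S0"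
    using assms(1) by (auto simp: k_subsets_def intro: finite_subset)
  obtain A B where A: "A \<subseteq> S0" "card A = k" "finite A" and B: "B \<subseteq> P - S0" "card B = k" "finite B"
    using obtain_subset_with_card_n[of k S0] obtain_subset_with_card_n[of k "P - S0"] S0' assms
    by (metis add_le_imp_le_diff card_Diff_subset add.commute)
  obtain xs ys where xs: "set xs = A" "distinct xs" and ys: "set ys = B" "distinct ys"
    using finite_distinct_list A(3) B(3) by metis
  then have len: "length xs = k" "length ys = k"
    using A(2) B(2) distinct_card by metis+
  define rs where "rs = zip xs ys"
  have rs: "map fst rs = xs" "map snd rs = ys" "length rs = k"
    unfolding rs_def using len by auto
  then have "rs \<noteq> []" using assms(2) by auto
  have mem: "fst r \<in> S0" "snd r \<in> P - S0" if "r \<in> set rs" for r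
    using that rs xs ys A B by (metis (no_types) image_eqI set_map subsetD)+
  let ?g = "\<lambda>w p. g w p / real k"
  have k: "0 < real k" using assms(2) by simp
  have "avg (k_subsets P m) (\<lambda>S. max_over W (\<lambda>w. avg (P - S) (g w) - avg S (g w)))
      \<le> avg (perms P) (\<lambda>\<pi>. max_over W (\<lambda>w. \<Sum>r\<leftarrow>rs. (g w (\<pi> (snd r)) - g w (\<pi> (fst r))) / real (length rs)))"
    by (rule avg_deviation_le_pairing) (use assms S0 mem \<open>rs \<noteq> []\<close> in auto)
  also have "\<dots> = avg (perms P) (\<lambda>\<pi>. max_over W (\<lambda>w. 0 + (\<Sum>r\<leftarrow>rs. ?g w (\<pi> (snd r)) - ?g w (\<pi> (fst r)))))"
    by (simp add: rs(3) diff_divide_distrib)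
  also have "\<dots> = avg (perms P) (\<lambda>\<pi>. rademacher W (map (\<lambda>r w. ?g w (\<pi> (snd r)) - ?g w (\<pi> (fst r))) rs) (\<lambda>_. 0))"
    by (rule avg_perms_symmetrise) (use assms(1) rs xs ys A B S0' in auto)
  also have "\<dots> \<le> avg (perms P) (\<lambda>\<pi>. 2 * L * \<Lambda> / sqrt (real k))"
  proof (rule avg_mono)
    fix \<pi> assume "\<pi> \<in> perms P"
    then have \<pi>: "\<pi> p \<in> P" if "p \<in> P" for p using that by (simp add: perms_def permutes_in_image)
    let ?ds = "map (\<lambda>r w. ?g w (\<pi> (snd r)) - ?g w (\<pi> (fst r))) rs"
    have "rademacher W ?ds (\<lambda>_. 0) = rademacher W ?ds (\<lambda>w. w \<bullet>\<^sub>v 0\<^sub>v D)"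
      using W(3) by (intro rademacher_cong) (auto simp: scalar_prod_right_zero[of _ D])
    also have "\<dots> \<le> \<Lambda> * sqrt (0\<^sub>v D \<bullet>\<^sub>v 0\<^sub>v D + 4 * (L / real k)\<^sup>2 * real (length ?ds))"
    proof (rule rademacher_dot_le)
      fix d assume "d \<in> set ?ds"
      then obtain r where r: "r \<in> set rs" "d = (\<lambda>w. ?g w (\<pi> (snd r)) - ?g w (\<pi> (fst r)))" by auto
      let ?p = "\<pi> (snd r)" and ?q = "\<pi> (fst r)"
      have pq: "?p \<in> P" "?q \<in> P" using \<pi> mem[OF r(1)] S0' by auto
      show "\<exists>a\<in>carrier_vec D. \<exists>b\<in>carrier_vec D. a \<bullet>\<^sub>v a \<le> 1 \<and> b \<bullet>\<^sub>v b \<le> 1 \<and>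
          (\<forall>w\<in>W. \<forall>w'\<in>W. \<bar>d w - d w'\<bar>
            \<le> L / real k * \<bar>w \<bullet>\<^sub>v a - w' \<bullet>\<^sub>v a\<bar> + L / real k * \<bar>w \<bullet>\<^sub>v b - w' \<bullet>\<^sub>v b\<bar>)"
      proof (rule bexI[of _ "v ?p"], rule bexI[of _ "v ?q"], intro conjI ballI)
        fix w w' assume w: "w \<in> W" "w' \<in> W"
        have "\<bar>d w - d w'\<bar> = \<bar>(g w ?p - g w' ?p) - (g w ?q - g w' ?q)\<bar> / real k"
        proof -
          have "d w - d w' = ((g w ?p - g w' ?p) - (g w ?q - g w' ?q)) / real k"
            by (simp add: r(2) diff_divide_distrib)
          then show ?thesis by simp
        qed
        also have "\<dots> \<le> (L * \<bar>w \<bullet>\<^sub>v v ?p - w' \<bullet>\<^sub>v v ?p\<bar> + L * \<bar>w \<bullet>\<^sub>v v ?q - w' \<bullet>\<^sub>v v ?q\<bar>) / real k"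
          using g[OF pq(1) w] g[OF pq(2) w] by (intro divide_right_mono) auto
        finally show "\<bar>d w - d w'\<bar> \<le> L / real k * \<bar>w \<bullet>\<^sub>v v ?p - w' \<bullet>\<^sub>v v ?p\<bar>
            + L / real k * \<bar>w \<bullet>\<^sub>v v ?q - w' \<bullet>\<^sub>v v ?q\<bar>"
          by (simp add: add_divide_distrib)
      qed (use v pq in auto)
    qed (use W in auto)
    also have "\<dots> = 2 * L * \<Lambda> / sqrt (real k)"
    proof -
      have "4 * (L / real k)\<^sup>2 * real (length ?ds) = (2 * L)\<^sup>2 / real k"
        using k rs(3) by (simp add: power2_eq_square field_simps)
      then have "sqrt (4 * (L / real k)\<^sup>2 * real (length ?ds)) = 2 * L / sqrt (real k)"
        using W(6) by (simp only: real_sqrt_divide real_sqrt_abs)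
      then show ?thesis using W(6) by simp
    qed
    finally show "rademacher W ?ds (\<lambda>_. 0) \<le> 2 * L * \<Lambda> / sqrt (real k)" .
  qed
  also have "\<dots> = 2 * L * \<Lambda> / sqrt (real k)"
    unfolding avg_def using card_perms_pos[OF assms(1)] by simp
  finally show ?thesis .
qed

subsection \<open>The largest eigenvalue\<close>

text \<open>The constant is the squared Frobenius norm, by Cauchy-Schwarz on each row. Only its
  finiteness matters below, once for \<open>K\<close> and once for an inverse matrix.\<close>

lemma mult_mat_vec_bounded:
  assumes "A \<in> carrier_mat m n"
  shows "\<exists>M\<ge>0. \<forall>v\<in>carrier_vec n. (A *\<^sub>v v) \<bullet>\<^sub>v (A *\<^sub>v v) \<le> M * (v \<bullet>\<^sub>v v)"
proof (intro exI conjI ballI)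
  let ?M = "\<Sum>i<m. Matrix.row A i \<bullet>\<^sub>v Matrix.row A i"
  show "0 \<le> ?M" by (intro sum_nonneg dot_self_nonneg)
  fix v :: "real Matrix.vec" assume v: "v \<in> carrier_vec n"
  have "(A *\<^sub>v v) \<bullet>\<^sub>v (A *\<^sub>v v) = (\<Sum>i<m. (Matrix.row A i \<bullet>\<^sub>v v)\<^sup>2)"
    using assms v by (subst dot_eq_sum[of _ m]) (auto simp: power2_eq_square intro!: sum.cong)
  also have "\<dots> \<le> (\<Sum>i<m. (Matrix.row A i \<bullet>\<^sub>v Matrix.row A i) * (v \<bullet>\<^sub>v v))"
    using assms v by (intro sum_mono dot_Cauchy_Schwarz[of _ n]) auto
  finally show "(A *\<^sub>v v) \<bullet>\<^sub>v (A *\<^sub>v v) \<le> ?M * (v \<bullet>\<^sub>v v)"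
    by (simp add: sum_distrib_right)
qed

lemma quadratic_nonneg_discriminant:
  fixes a b c :: real
  assumes "\<And>t. 0 \<le> a + 2 * b * t + c * t\<^sup>2" "0 \<le> c"
  shows "b\<^sup>2 \<le> a * c"
proof (cases "c = 0")
  case True
  have "b = 0"
  proof (rule ccontr)
    assume "b \<noteq> 0"
    \<comment> \<open>At this \<open>t\<close> the expression takes the value -1.\<close>
    then show False using assms(1)[of "- (a + 1) / (2 * b)"] True by simp
  qed
  then show ?thesis using True by simp
next
  case False
  then have c: "0 < c" using assms(2) by simp
  have "0 \<le> a - b\<^sup>2 / c"
    using assms(1)[of "- b / c"] c by (simp add: power2_eq_square field_simps)
  then show ?thesis using c by (simp add: field_simps)
qed

text \<open>If the supremum of the Rayleigh quotient were not an eigenvalue, the form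
  \<open>\<mu> (x \<bullet> x) - x \<bullet> K x\<close> would be bounded below by a positive multiple of \<open>x \<bullet> x\<close>, by
  Cauchy-Schwarz for this form and boundedness of the inverse matrix.\<close>
lemma quadratic_form_le_lambda1:
  assumes K: "K \<in> carrier_mat n n" and sym: "transpose_mat K = K" and n: "0 < n"
    and v: "v \<in> carrier_vec n"
  shows "v \<bullet>\<^sub>v (K *\<^sub>v v) \<le> lambda1 K * (v \<bullet>\<^sub>v v)"
proof -
  define R where "R = {x \<bullet>\<^sub>v (K *\<^sub>v x) | x. x \<in> carrier_vec n \<and> x \<bullet>\<^sub>v x = 1}"
  define \<mu> where "\<mu> = Sup R"
  obtain M where M: "0 \<le> M" "\<And>x. x \<in> carrier_vec n \<Longrightarrow> (K *\<^sub>v x) \<bullet>\<^sub>v (K *\<^sub>v x) \<le> M * (x \<bullet>\<^sub>v x)"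
    using mult_mat_vec_bounded[OF K] by auto
  have Kx: "K *\<^sub>v x \<in> carrier_vec n" if "x \<in> carrier_vec n" for x using that K by simp
  have bdd: "bdd_above R"
  proof (rule bdd_aboveI)
    fix r assume "r \<in> R"
    then obtain x where x: "x \<in> carrier_vec n" "x \<bullet>\<^sub>v x = 1" "r = x \<bullet>\<^sub>v (K *\<^sub>v x)" by (auto simp: R_def)
    have "r\<^sup>2 \<le> (x \<bullet>\<^sub>v x) * ((K *\<^sub>v x) \<bullet>\<^sub>v (K *\<^sub>v x))"
      unfolding x(3) using x Kx by (intro dot_Cauchy_Schwarz[of _ n]) auto
    also have "\<dots> \<le> M" using M(2)[OF x(1)] x(2) by simp
    also have "M \<le> (1 + M)\<^sup>2" using M(1) by (simp add: power2_eq_square algebra_simps)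
    finally show "r \<le> 1 + M" by (rule power2_le_imp_le) (use M(1) in simp)
  qed
  have e: "unit_vec n 0 \<in> carrier_vec n" "unit_vec n 0 \<bullet>\<^sub>v unit_vec n 0 = (1::real)" using n by auto
  then have ne: "R \<noteq> {}" unfolding R_def by blast
  have \<mu>: "x \<bullet>\<^sub>v (K *\<^sub>v x) \<le> \<mu> * (x \<bullet>\<^sub>v x)" if x: "x \<in> carrier_vec n" for x
  proof (cases "x = 0\<^sub>v n")
    case True
    then show ?thesis using K by (simp add: Kx)
  next
    case False
    define s where "s = sqrt (x \<bullet>\<^sub>v x)"
    have s: "0 < s" "s\<^sup>2 = x \<bullet>\<^sub>v x" unfolding s_def using dot_self_pos[OF x False] by auto
    let ?z = "(1 / s) \<cdot>\<^sub>v x"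
    have "?z \<bullet>\<^sub>v ?z = (x \<bullet>\<^sub>v x) / s\<^sup>2"
      using x by (simp add: smult_scalar_prod_distrib[of _ n] scalar_prod_smult_distrib[of _ n] power2_eq_square)
    then have "?z \<bullet>\<^sub>v ?z = 1" using s by (metis divide_self_if less_irrefl zero_less_power)
    moreover have "?z \<bullet>\<^sub>v (K *\<^sub>v ?z) = (x \<bullet>\<^sub>v (K *\<^sub>v x)) / s\<^sup>2"
      using x K Kx by (simp add: mult_mat_vec[of _ n n] smult_scalar_prod_distrib[of _ n] scalar_prod_smult_distrib[of _ n] power2_eq_square)
    ultimately have "(x \<bullet>\<^sub>v (K *\<^sub>v x)) / s\<^sup>2 \<in> R" using x unfolding R_def by (smt (verit) mem_Collect_eq smult_carrier_vec)
    then have "(x \<bullet>\<^sub>v (K *\<^sub>v x)) / s\<^sup>2 \<le> \<mu>" unfolding \<mu>_def by (rule cSup_upper[OF _ bdd])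
    then show ?thesis using s by (metis pos_divide_le_eq zero_less_power)
  qed
  have "eigenvalue K \<mu>"
  proof (rule ccontr)
    assume "\<not> eigenvalue K \<mu>"
    let ?A = "char_matrix K \<mu>"
    have A: "?A \<in> carrier_mat n n" using K by simp
    have Ax: "?A *\<^sub>v x = K *\<^sub>v x - \<mu> \<cdot>\<^sub>v x" if "x \<in> carrier_vec n" for x
      unfolding char_matrix_def using K that
      by (intro eq_vecI) (auto simp: add_scalar_prod_distrib[of _ n] smult_scalar_prod_distrib[of _ n])
    have "Determinant.det ?A \<noteq> 0" using \<open>\<not> eigenvalue K \<mu>\<close> eigenvalue_det[OF K] by simp
    then obtain B where B: "B \<in> carrier_mat n n" "?A * B = 1\<^sub>m n"
      using det_non_zero_imp_unit[OF A, of undefined] unfolding Units_def by (auto simp: ring_mat_simps)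
    obtain M' where M': "0 \<le> M'" "\<And>x. x \<in> carrier_vec n \<Longrightarrow> (B *\<^sub>v x) \<bullet>\<^sub>v (B *\<^sub>v x) \<le> M' * (x \<bullet>\<^sub>v x)"
      using mult_mat_vec_bounded[OF B(1)] by auto
    define q where "q x y = \<mu> * (x \<bullet>\<^sub>v y) - x \<bullet>\<^sub>v (K *\<^sub>v y)" for x y
    have gap: "r \<le> \<mu> - 1 / (1 + M')" if r: "r \<in> R" for r
    proof -
      obtain x where x: "x \<in> carrier_vec n" "x \<bullet>\<^sub>v x = 1" "r = x \<bullet>\<^sub>v (K *\<^sub>v x)"
        using r by (auto simp: R_def)
      \<comment> \<open>With \<open>y\<close> the image of \<open>x\<close> under the inverse of
        \<open>?A\<close>, the form gives \<open>q x y = - 1\<close> and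
        \<open>q y y = - (y \<bullet>\<^sub>v x)\<close>. Cauchy-Schwarz for \<open>q\<close> then
        reads \<open>1 \<le> q x x * q y y\<close>, and the bound on \<open>B\<close> caps
        \<open>q y y\<close> at \<open>1 + M'\<close>.\<close>
      define y where "y = B *\<^sub>v x"
      have y: "y \<in> carrier_vec n" unfolding y_def using B x by simp
      have "?A *\<^sub>v y = x" unfolding y_def using A B x
        by (subst assoc_mult_mat_vec[symmetric, of _ n n _ n]) auto
      then have Ky: "K *\<^sub>v y - \<mu> \<cdot>\<^sub>v y = x" using Ax y by simp
      have qz: "q z y = - (z \<bullet>\<^sub>v x)" if "z \<in> carrier_vec n" for z
        unfolding q_def using that y Kx[OF y]
        by (subst Ky[symmetric])
          (simp add: scalar_prod_minus_distrib[of _ n] scalar_prod_smult_distrib[of _ n])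
      have "0 \<le> q x x + 2 * q x y * t + q y y * t\<^sup>2" for t
      proof -
        have "0 \<le> q (x + t \<cdot>\<^sub>v y) (x + t \<cdot>\<^sub>v y)"
          unfolding q_def using \<mu>[of "x + t \<cdot>\<^sub>v y"] x y by simp
        also have "\<dots> = q x x + t * q x y + t * q y x + t * t * q y y"
          unfolding q_def using x y Kx K
          by (simp add: mult_add_distrib_mat_vec[of _ n n] mult_mat_vec[of _ n n]
              add_scalar_prod_distrib[of _ n] scalar_prod_add_distrib[of _ n]
              smult_scalar_prod_distrib[of _ n] scalar_prod_smult_distrib[of _ n] algebra_simps)
        also have "q y x = q x y"
          unfolding q_def using comm_scalar_prod[OF x(1) y] transpose_vec_mult_scalar[OF K x(1) y] sym
            comm_scalar_prod[OF x(1) Kx[OF y]] transpose_vec_mult_scalar[OF K y x(1)] by simp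
        finally show ?thesis by (simp add: power2_eq_square algebra_simps)
      qed
      moreover have "0 \<le> q y y" unfolding q_def using \<mu>[OF y] by simp
      ultimately have "(q x y)\<^sup>2 \<le> q x x * q y y" by (rule quadratic_nonneg_discriminant)
      then have 1: "1 \<le> q x x * q y y" using qz[OF x(1)] x(2) by simp
      have "(y \<bullet>\<^sub>v x)\<^sup>2 \<le> (y \<bullet>\<^sub>v y) * (x \<bullet>\<^sub>v x)" using x y by (intro dot_Cauchy_Schwarz)
      also have "\<dots> \<le> M'" using M'(2)[OF x(1)] x(2) by (simp add: y_def)
      also have "M' \<le> (1 + M')\<^sup>2" using M'(1) by (simp add: power2_eq_square algebra_simps)
      finally have "(q y y)\<^sup>2 \<le> (1 + M')\<^sup>2" using qz[OF y] by simp
      then have 2: "q y y \<le> 1 + M'" by (rule power2_le_imp_le) (use M'(1) in simp)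
      have "0 \<le> q x x" unfolding q_def using \<mu>[OF x(1)] by simp
      then have "1 \<le> q x x * (1 + M')" using 1 mult_left_mono[OF 2, of "q x x"] by linarith
      then have "1 / (1 + M') \<le> q x x" using M'(1) by (simp add: divide_le_eq)
      then show ?thesis unfolding x(3) q_def using x(2) by simp
    qed
    have "\<mu> \<le> \<mu> - 1 / (1 + M')"
      unfolding \<mu>_def by (rule cSup_least[OF ne]) (use gap in \<open>simp add: \<mu>_def\<close>)
    then show False using M'(1) by (simp add: divide_le_0_iff)
  qed
  \<comment> \<open>The eigenvalues are the roots of a nonzero polynomial; their finiteness makes
    the \<open>Max\<close> in \<open>lambda1\<close> a genuine maximum.\<close>
  moreover have "finite {k. eigenvalue K k}"
  proof -
    have "char_poly K \<noteq> 0" using degree_monic_char_poly[OF K] by auto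
    then show ?thesis unfolding eigenvalue_root_char_poly[OF K] by (rule poly_roots_finite)
  qed
  ultimately have "\<mu> \<le> lambda1 K" unfolding lambda1_def by (intro Max_ge) auto
  then have "\<mu> * (v \<bullet>\<^sub>v v) \<le> lambda1 K * (v \<bullet>\<^sub>v v)" by (intro mult_right_mono dot_self_nonneg)
  then show ?thesis using \<mu>[OF v] by linarith
qed

subsection \<open>Kronecker features and the norm of the solution\<close>

text \<open>\<open>U\<close> and its transpose have the same operator norm: for
  \<open>z = transpose_mat U *\<^sub>v v\<close> one has
  \<open>z \<bullet>\<^sub>v z = v \<bullet>\<^sub>v (U *\<^sub>v z)\<close>, and Cauchy-Schwarz
  with the Rayleigh bound for the Gram matrix lets one factor \<open>z \<bullet>\<^sub>v z\<close>
  cancel. Coordinates are written out because \<open>x\<close> will run through slices and partial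
  products of a vector of length \<open>d * d\<close>.\<close>

lemma gram_sum_le:
  fixes x :: "nat \<Rightarrow> real"
  assumes U: "U \<in> carrier_mat d n" and n: "0 < n"
  shows "0 \<le> lambda1 (transpose_mat U * U)"
    and "(\<Sum>i<n. (\<Sum>s<d. x s * U $$ (s, i))\<^sup>2) \<le> lambda1 (transpose_mat U * U) * (\<Sum>s<d. (x s)\<^sup>2)"
proof -
  let ?K = "transpose_mat U * U"
  let ?l = "lambda1 ?K"
  have K: "?K \<in> carrier_mat n n" using U by simp
  have sym: "transpose_mat ?K = ?K"
    using U by (subst transpose_mult[of _ n d _ n]) auto
  have Uv: "(U *\<^sub>v v) \<bullet>\<^sub>v (U *\<^sub>v v) \<le> ?l * (v \<bullet>\<^sub>v v)" if v: "v \<in> carrier_vec n" for v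
  proof -
    have "(U *\<^sub>v v) \<bullet>\<^sub>v (U *\<^sub>v v) = v \<bullet>\<^sub>v (?K *\<^sub>v v)"
    proof -
      have c: "U *\<^sub>v v \<in> carrier_vec d" using U v by simp
      have "(U *\<^sub>v v) \<bullet>\<^sub>v (U *\<^sub>v v) = (transpose_mat U *\<^sub>v (U *\<^sub>v v)) \<bullet>\<^sub>v v"
        using transpose_vec_mult_scalar[OF U v c] by simp
      also have "\<dots> = v \<bullet>\<^sub>v (transpose_mat U *\<^sub>v (U *\<^sub>v v))"
        using U v c by (intro comm_scalar_prod[of _ n]) auto
      finally show ?thesis using U v by (simp add: assoc_mult_mat_vec[of _ n d _ n])
    qed
    then show ?thesis using quadratic_form_le_lambda1[OF K sym n v] by simp
  qed
  have "unit_vec n 0 \<bullet>\<^sub>v unit_vec n 0 = (1::real)" "unit_vec n 0 \<in> carrier_vec n" using n by auto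
  then show l: "0 \<le> ?l"
    using Uv[of "unit_vec n 0"] dot_self_nonneg[of "U *\<^sub>v unit_vec n 0"] by simp
  define v where "v = Matrix.vec d x"
  define z where "z = transpose_mat U *\<^sub>v v"
  have v: "v \<in> carrier_vec d" and z: "z \<in> carrier_vec n" and Uz: "U *\<^sub>v z \<in> carrier_vec d"
    unfolding v_def z_def using U by auto
  have zz: "z \<bullet>\<^sub>v z = v \<bullet>\<^sub>v (U *\<^sub>v z)"
    using transpose_vec_mult_scalar[OF U z v] by (simp add: z_def)
  have "(z \<bullet>\<^sub>v z)\<^sup>2 \<le> (v \<bullet>\<^sub>v v) * ((U *\<^sub>v z) \<bullet>\<^sub>v (U *\<^sub>v z))"
    unfolding zz by (rule dot_Cauchy_Schwarz[OF v Uz])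
  also have "\<dots> \<le> (v \<bullet>\<^sub>v v) * (?l * (z \<bullet>\<^sub>v z))"
    by (intro mult_left_mono Uv z dot_self_nonneg)
  finally have sq: "(z \<bullet>\<^sub>v z) * (z \<bullet>\<^sub>v z) \<le> (?l * (v \<bullet>\<^sub>v v)) * (z \<bullet>\<^sub>v z)"
    by (simp add: power2_eq_square mult_ac)
  have "z \<bullet>\<^sub>v z \<le> ?l * (v \<bullet>\<^sub>v v)"
  proof (cases "z \<bullet>\<^sub>v z = 0")
    case True
    then show ?thesis using l dot_self_nonneg[of v] by simp
  next
    case False
    then have "0 < z \<bullet>\<^sub>v z" using dot_self_nonneg[of z] by linarith
    with sq show ?thesis by (rule mult_right_le_imp_le)
  qed
  moreover have "v \<bullet>\<^sub>v v = (\<Sum>s<d. (x s)\<^sup>2)"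
    using v by (subst dot_eq_sum[of _ d]) (auto simp: v_def power2_eq_square)
  moreover have "z \<bullet>\<^sub>v z = (\<Sum>i<n. (\<Sum>s<d. x s * U $$ (s, i))\<^sup>2)"
  proof -
    have "vec_index z i = (\<Sum>s<d. x s * U $$ (s, i))" if "i < n" for i
      unfolding z_def using that U v
      by (subst index_mult_mat_vec) (auto simp: dot_eq_sum[OF v, unfolded v_def] v_def mult.commute intro!: sum.cong)
    then show ?thesis using z by (subst dot_eq_sum[of _ n]) (auto simp: power2_eq_square)
  qed
  ultimately show "(\<Sum>i<n. (\<Sum>s<d. x s * U $$ (s, i))\<^sup>2) \<le> ?l * (\<Sum>s<d. (x s)\<^sup>2)" by simp
qed

section \<open>Inner products and norms of the tensor features\<close>

lemma sum_lessThan_mult: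
  fixes f :: "nat \<Rightarrow> 'a::comm_monoid_add"
  shows "(\<Sum>t<d * d. f t) = (\<Sum>a<d. \<Sum>b<d. f (a * d + b))"
proof -
  have "(\<Sum>t<d * d. f t) = (\<Sum>a<d. sum f {a * d..<a * d + d})"
    by (rule sum.nat_group[symmetric])
  also have "\<dots> = (\<Sum>a<d. \<Sum>b<d. f (a * d + b))"
    by (simp add: sum.atLeastLessThan_shift_0[of _ "_ * d"] lessThan_atLeast0)
  finally show ?thesis .
qed

lemma kron_col_carrier [simp]: "kron_col U i j \<in> carrier_vec (dim_row U * dim_row U)"
  unfolding kron_col_def by simp

text \<open>Read as a \<open>d\<close> by \<open>d\<close> matrix with entry \<open>(a, b)\<close>
  at index \<open>a * d + b\<close>, the vector \<open>w\<close> defines a bilinear form, and this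
  is its value at columns \<open>i\<close> and \<open>j\<close> of \<open>U\<close>.\<close>

lemma dot_kron_col:
  assumes "dim_row U = d"
  shows "w \<bullet>\<^sub>v kron_col U i j
    = (\<Sum>a<d. (\<Sum>b<d. vec_index w (a * d + b) * U $$ (b, j)) * U $$ (a, i))"
proof -
  have lt: "a * d + b < d * d" if "a < d" "b < d" for a b :: nat
  proof -
    have "a * d + b < Suc a * d" using that by simp
    also have "\<dots> \<le> d * d" using that by (intro mult_le_mono1) simp
    finally show ?thesis .
  qed
  have "w \<bullet>\<^sub>v kron_col U i j = (\<Sum>t<d * d. vec_index w t * vec_index (kron_col U i j) t)"
    using assms by (intro dot_eq_sum) auto
  also have "\<dots> = (\<Sum>a<d. \<Sum>b<d. vec_index w (a * d + b) * vec_index (kron_col U i j) (a * d + b))"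
    by (rule sum_lessThan_mult)
  also have "\<dots> = (\<Sum>a<d. (\<Sum>b<d. vec_index w (a * d + b) * U $$ (b, j)) * U $$ (a, i))"
    using assms lt by (auto simp: kron_col_def sum_distrib_left mult_ac intro!: sum.cong)
  finally show ?thesis .
qed

lemma kron_col_norm:
  assumes "in_Lab n E U" "i < n" "j < n"
  shows "kron_col U i j \<bullet>\<^sub>v kron_col U i j = 1"
proof -
  let ?d = "dim_row U"
  have u: "(\<Sum>a<?d. U $$ (a, k) * U $$ (a, k)) = 1" if "k < n" for k
  proof -
    have "col U k \<bullet>\<^sub>v col U k = (\<Sum>a<?d. U $$ (a, k) * U $$ (a, k))"
      using that assms(1) by (subst dot_eq_sum[of _ ?d]) (auto simp: in_Lab_def)
    then show ?thesis using that assms(1) by (simp add: in_Lab_def)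
  qed
  have "kron_col U i j \<bullet>\<^sub>v kron_col U i j
      = (\<Sum>t<?d * ?d. (U $$ (t div ?d, i) * U $$ (t mod ?d, j)) * (U $$ (t div ?d, i) * U $$ (t mod ?d, j)))"
    by (subst dot_eq_sum[OF kron_col_carrier]) (simp add: kron_col_def)
  also have "\<dots> = (\<Sum>a<?d. \<Sum>b<?d. (U $$ (a, i) * U $$ (a, i)) * (U $$ (b, j) * U $$ (b, j)))"
    unfolding sum_lessThan_mult by (auto intro!: sum.cong)
  also have "\<dots> = 1"
    unfolding sum_product[symmetric] using u assms by simp
  finally show ?thesis .
qed

text \<open>The bound for \<open>U\<close> is applied once per tensor factor: first over
  \<open>i\<close> with \<open>j\<close> fixed, then over \<open>j\<close> with the first tensor
  index \<open>a\<close> fixed. Each application contributes one factor \<open>?l\<close>.\<close>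

lemma sum_dot_kron_col_sq_le:
  assumes "dim_col U = n" "0 < n" "w \<in> carrier_vec (dim_row U * dim_row U)"
  shows "(\<Sum>i<n. \<Sum>j<n. (w \<bullet>\<^sub>v kron_col U i j)\<^sup>2) \<le> (lambda1 (transpose_mat U * U))\<^sup>2 * (w \<bullet>\<^sub>v w)"
proof -
  define d where "d = dim_row U"
  let ?l = "lambda1 (transpose_mat U * U)"
  have U: "U \<in> carrier_mat d n" using assms d_def by auto
  note le = gram_sum_le[OF U assms(2)]
  define X where "X j a = (\<Sum>b<d. vec_index w (a * d + b) * U $$ (b, j))" for j a
  have "(\<Sum>i<n. \<Sum>j<n. (w \<bullet>\<^sub>v kron_col U i j)\<^sup>2) = (\<Sum>j<n. \<Sum>i<n. (\<Sum>a<d. X j a * U $$ (a, i))\<^sup>2)"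
    unfolding dot_kron_col[OF d_def[symmetric]] X_def by (rule sum.swap)
  also have "\<dots> \<le> (\<Sum>j<n. ?l * (\<Sum>a<d. (X j a)\<^sup>2))"
    by (intro sum_mono le)
  also have "\<dots> = ?l * (\<Sum>a<d. \<Sum>j<n. (X j a)\<^sup>2)"
    unfolding sum_distrib_left[symmetric] by (subst sum.swap) simp
  also have "\<dots> \<le> ?l * (\<Sum>a<d. ?l * (\<Sum>b<d. (vec_index w (a * d + b))\<^sup>2))"
    unfolding X_def by (intro mult_left_mono sum_mono le)
  also have "\<dots> = ?l\<^sup>2 * (\<Sum>t<d * d. (vec_index w t)\<^sup>2)"
    unfolding sum_lessThan_mult by (simp add: sum_distrib_left power2_eq_square mult_ac)
  also have "(\<Sum>t<d * d. (vec_index w t)\<^sup>2) = w \<bullet>\<^sub>v w"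
    using assms(3) d_def by (subst dot_eq_sum[of _ "d * d"]) (auto simp: power2_eq_square)
  finally show ?thesis .
qed

section \<open>Norm of the Pref-Rank output\<close>

lemma hinge_scale_le:
  assumes "\<bar>y\<bar> = 1" "0 \<le> t"
  shows "hinge (y * ((1 - t) * s)) \<le> hinge (y * s) + t * \<bar>s\<bar>"
proof -
  have "y * ((1 - t) * s) = y * s - t * (y * s)" by (simp add: algebra_simps)
  moreover have "t * (y * s) \<le> t * \<bar>s\<bar>"
    using assms abs_ge_self[of "y * s"] by (intro mult_left_mono) (auto simp: abs_mult)
  moreover have "0 \<le> t * \<bar>s\<bar>" using assms by simp
  ultimately show ?thesis unfolding hinge_def by linarith
qed

lemma finite_pairs [simp]: "finite (pairs n)"
  by (rule finite_subset[of _ "{..<n} \<times> {..<n}"]) (auto simp: pairs_def)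

text \<open>Optimality of \<open>w\<close> against \<open>(1 - t) w\<close> for small \<open>t > 0\<close> replaces Lagrangian duality.\<close>
lemma prefrank_sol_norm_le:
  assumes sol: "is_prefrank_sol C U y S w" and S: "S \<subseteq> pairs n"
    and y: "\<And>p. p \<in> S \<Longrightarrow> \<bar>y p\<bar> = 1" and "0 < C" "dim_col U = n" "0 < n"
  shows "w \<bullet>\<^sub>v w \<le> (C * lambda1 (transpose_mat U * U) * sqrt (real (card S)))\<^sup>2"
proof -
  let ?D = "dim_row U * dim_row U" and ?l = "lambda1 (transpose_mat U * U)"
  define s where "s p = w \<bullet>\<^sub>v kron_col U (fst p) (snd p)" for p
  have fin: "finite S" using S by (rule finite_subset) simp
  have w: "w \<in> carrier_vec ?D" using sol by (simp add: is_prefrank_sol_def)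
  have l: "0 \<le> ?l" using assms by (intro gram_sum_le(1)[of _ "dim_row U" n]) auto
  define R where "R = C * (\<Sum>p\<in>S. \<bar>s p\<bar>)"
  have shrink: "(1 - t / 2) * (w \<bullet>\<^sub>v w) \<le> R" if t: "0 < t" for t
  proof -
    let ?v = "(1 - t) \<cdot>\<^sub>v w"
    have sv: "?v \<bullet>\<^sub>v kron_col U (fst p) (snd p) = (1 - t) * s p" for p
      unfolding s_def using w by (simp add: smult_scalar_prod_distrib[of _ ?D])
    have vv: "?v \<bullet>\<^sub>v ?v = (1 - t)\<^sup>2 * (w \<bullet>\<^sub>v w)"
      using w by (simp add: smult_scalar_prod_distrib[of _ ?D] scalar_prod_smult_distrib[of _ ?D] power2_eq_square)
    have "prefrank_obj C U y S w \<le> prefrank_obj C U y S ?v"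
      using sol w unfolding is_prefrank_sol_def by simp
    then have "1/2 * (w \<bullet>\<^sub>v w) + C * (\<Sum>p\<in>S. hinge (y p * s p))
        \<le> 1/2 * ((1 - t)\<^sup>2 * (w \<bullet>\<^sub>v w)) + C * (\<Sum>p\<in>S. hinge (y p * ((1 - t) * s p)))"
      unfolding prefrank_obj_def sv vv s_def .
    also have "(\<Sum>p\<in>S. hinge (y p * ((1 - t) * s p))) \<le> (\<Sum>p\<in>S. hinge (y p * s p) + t * \<bar>s p\<bar>)"
      using y t by (intro sum_mono hinge_scale_le) auto
    finally have "1/2 * (w \<bullet>\<^sub>v w) + C * (\<Sum>p\<in>S. hinge (y p * s p))
        \<le> 1/2 * ((1 - t)\<^sup>2 * (w \<bullet>\<^sub>v w)) + C * (\<Sum>p\<in>S. hinge (y p * s p) + t * \<bar>s p\<bar>)"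
      using assms(4) by simp
    \<comment> \<open>Since \<open>(1 - (1 - t)\<^sup>2) / 2 = t * (1 - t / 2)\<close>, both sides
      carry a factor \<open>t\<close> once the hinge losses at \<open>w\<close> cancel.\<close>
    then have "t * ((1 - t / 2) * (w \<bullet>\<^sub>v w)) \<le> t * R"
      unfolding R_def sum.distrib sum_distrib_left[symmetric]
      by (simp add: algebra_simps power2_eq_square)
    then show ?thesis using t by simp
  qed
  have "w \<bullet>\<^sub>v w \<le> R"
  proof (rule ccontr)
    assume "\<not> ?thesis"
    then have gt: "R < w \<bullet>\<^sub>v w" by simp
    have "0 \<le> R" unfolding R_def using assms(4) by (simp add: sum_nonneg)
    with gt have pos: "0 < w \<bullet>\<^sub>v w" by simp
    \<comment> \<open>This \<open>t\<close> places
      \<open>(1 - t / 2) * (w \<bullet>\<^sub>v w)\<close> midway between \<open>R\<close> and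
      \<open>w \<bullet>\<^sub>v w\<close>, hence above \<open>R\<close>.\<close>
    define t where "t = (w \<bullet>\<^sub>v w - R) / (w \<bullet>\<^sub>v w)"
    have "0 < t" unfolding t_def using gt pos by simp
    moreover have "(1 - t / 2) * (w \<bullet>\<^sub>v w) = (w \<bullet>\<^sub>v w + R) / 2"
      unfolding t_def using pos by (simp add: field_simps)
    ultimately show False using shrink[of t] gt by simp
  qed
  moreover have "R \<le> C * ?l * sqrt (real (card S)) * sqrt (w \<bullet>\<^sub>v w)"
  proof -
    have "(\<Sum>p\<in>S. \<bar>s p\<bar>)\<^sup>2 = (\<Sum>p\<in>S. 1 * \<bar>s p\<bar>)\<^sup>2" by simp
    also have "\<dots> \<le> (\<Sum>p\<in>S. 1\<^sup>2) * (\<Sum>p\<in>S. \<bar>s p\<bar>\<^sup>2)" by (rule Cauchy_Schwarz_ineq_sum)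
    also have "\<dots> = real (card S) * (\<Sum>p\<in>S. (s p)\<^sup>2)" by simp
    \<comment> \<open>The sum over \<open>S\<close> is enlarged to all ordered index pairs, where
      the tensor bound applies.\<close>
    also have "(\<Sum>p\<in>S. (s p)\<^sup>2) \<le> (\<Sum>p\<in>{..<n} \<times> {..<n}. (s p)\<^sup>2)"
      using S by (intro sum_mono2) (auto simp: pairs_def)
    also have "\<dots> = (\<Sum>i<n. \<Sum>j<n. (w \<bullet>\<^sub>v kron_col U i j)\<^sup>2)"
      by (simp add: sum.cartesian_product s_def case_prod_beta)
    also have "\<dots> \<le> ?l\<^sup>2 * (w \<bullet>\<^sub>v w)"
      using assms w by (intro sum_dot_kron_col_sq_le) auto
    finally have "(\<Sum>p\<in>S. \<bar>s p\<bar>)\<^sup>2 \<le> real (card S) * (?l\<^sup>2 * (w \<bullet>\<^sub>v w))"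
      by (simp add: mult_left_mono)
    also have "\<dots> = (?l * sqrt (real (card S)) * sqrt (w \<bullet>\<^sub>v w))\<^sup>2"
      by (simp add: power_mult_distrib dot_self_nonneg)
    finally have "(\<Sum>p\<in>S. \<bar>s p\<bar>) \<le> ?l * sqrt (real (card S)) * sqrt (w \<bullet>\<^sub>v w)"
      by (rule power2_le_imp_le) (use l in \<open>simp add: dot_self_nonneg\<close>)
    then show ?thesis unfolding R_def using assms(4) by (simp add: mult.assoc)
  qed
  ultimately have le: "w \<bullet>\<^sub>v w \<le> (C * ?l * sqrt (real (card S))) * sqrt (w \<bullet>\<^sub>v w)" by linarith
  have "sqrt (w \<bullet>\<^sub>v w) \<le> C * ?l * sqrt (real (card S))"
  proof (cases "w \<bullet>\<^sub>v w = 0")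
    case True
    then show ?thesis using l assms(4) by simp
  next
    case False
    then have "0 < sqrt (w \<bullet>\<^sub>v w)" using dot_self_nonneg[of w] by simp
    moreover have "sqrt (w \<bullet>\<^sub>v w) * sqrt (w \<bullet>\<^sub>v w) \<le> (C * ?l * sqrt (real (card S))) * sqrt (w \<bullet>\<^sub>v w)"
      using le dot_self_nonneg[of w] by simp
    ultimately show ?thesis by (rule mult_right_le_imp_le[rotated])
  qed
  then have "(sqrt (w \<bullet>\<^sub>v w))\<^sup>2 \<le> (C * ?l * sqrt (real (card S)))\<^sup>2"
    by (intro power_mono) (auto simp: dot_self_nonneg)
  then show ?thesis by (simp add: dot_self_nonneg)
qed

subsection \<open>The generalisation bound\<close>

lemma card_pairs: "card (pairs n) = n choose 2"
proof (induction n)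
  case 0
  have "pairs 0 = {}" by (auto simp: pairs_def)
  then show ?case by simp
next
  case (Suc n)
  have eq: "pairs (Suc n) = pairs n \<union> (\<lambda>i. (i, n)) ` {..<n}"
    by (auto simp: pairs_def less_Suc_eq)
  have "card (pairs (Suc n)) = card (pairs n) + card ((\<lambda>i. (i, n)) ` {..<n})"
    unfolding eq by (rule card_Un_disjoint) (simp, simp, auto simp: pairs_def)
  also have "card ((\<lambda>i. (i, n)) ` {..<n}) = n" by (simp add: card_image inj_on_def)
  finally show ?case using Suc by (simp add: numeral_2_eq_2)
qed

text \<open>An exchange moves the two averages in opposite directions by
  \<open>g w j - g w i\<close> divided by their sizes, so the effects on their difference add up.
  Values in \<open>[0, B]\<close> differ by at most \<open>B\<close>, and the maximum over
  \<open>W\<close> inherits the bound.\<close>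

lemma deviation_swap_bounded:
  assumes "finite P" "0 < m" "m < card P" "finite W" "W \<noteq> {}"
    and g: "\<And>w p. w \<in> W \<Longrightarrow> p \<in> P \<Longrightarrow> 0 \<le> g w p \<and> g w p \<le> B"
  shows "swap_bounded P m (B * (1 / real m + 1 / real (card P - m)))
      (\<lambda>S. max_over W (\<lambda>w. avg (P - S) (g w) - avg S (g w)))"
  unfolding swap_bounded_def
proof (intro ballI max_over_diff_le)
  fix S i j w assume S: "S \<in> k_subsets P m" and i: "i \<in> S" and j: "j \<in> P - S" and w: "w \<in> W"
  let ?T = "insert j (S - {i})" and ?u = "card P - m"
  have S': "S \<subseteq> P" "card S = m" "finite S" using S assms(1) by (auto simp: k_subsets_def intro: finite_subset)
  have T: "card ?T = m" using S' i j assms(2) by (simp add: card_insert_if)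
  have co: "P - ?T = insert i (P - S - {j})" using i j S' by auto
  have cards: "card (P - S) = ?u" "card (P - ?T) = ?u"
  proof -
    show "card (P - S) = ?u" using S' by (simp add: card_Diff_subset)
    have "?T \<subseteq> P" using S' j by auto
    then show "card (P - ?T) = ?u" using S' T by (subst card_Diff_subset) auto
  qed
  have s1: "sum f ?T = sum f S - f i + f j" for f :: "'a \<Rightarrow> real"
    using S' i j by (simp add: sum_diff1)
  have s2: "sum f (P - ?T) = sum f (P - S) - f j + f i" for f :: "'a \<Rightarrow> real"
    unfolding co using assms(1) i j by (simp add: sum_diff1)
  have "\<bar>(avg (P - S) (g w) - avg S (g w)) - (avg (P - ?T) (g w) - avg ?T (g w))\<bar>
      = \<bar>(g w j - g w i) * (1 / real m + 1 / real ?u)\<bar>"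
    unfolding avg_def cards T S'(2) s1 s2 by (simp add: algebra_simps diff_divide_distrib add_divide_distrib)
  also have "\<dots> = \<bar>g w j - g w i\<bar> * (1 / real m + 1 / real ?u)"
    unfolding abs_mult by (subst (2) abs_of_nonneg) auto
  also have "\<dots> \<le> B * (1 / real m + 1 / real ?u)"
  proof (rule mult_right_mono)
    have "i \<in> P" "j \<in> P" using i j S' by auto
    then show "\<bar>g w j - g w i\<bar> \<le> B" using g[OF w, of i] g[OF w, of j] by linarith
  qed simp
  finally show "\<bar>(avg (P - S) (g w) - avg S (g w)) - (avg (P - ?T) (g w) - avg ?T (g w))\<bar>
      \<le> B * (1 / real m + 1 / real ?u)" .
qed (use assms in auto)

lemma prob_pmf_of_set_ge:
  assumes "finite A" "A \<noteq> {}" "real (card {S \<in> A. \<not> Q S}) / real (card A) \<le> \<delta>"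
  shows "1 - \<delta> \<le> measure_pmf.prob (pmf_of_set A) {S. Q S}"
proof -
  have "card A = card (A \<inter> {S. Q S}) + card {S \<in> A. \<not> Q S}"
    using assms(1) by (subst card_Un_disjoint[symmetric]) (auto intro: arg_cong[where f = card])
  moreover have "0 < card A" using assms by (simp add: card_gt_0_iff)
  ultimately have "real (card (A \<inter> {S. Q S})) = real (card A) - real (card {S \<in> A. \<not> Q S})" "0 < card A"
    by linarith+
  then have "real (card (A \<inter> {S. Q S})) / real (card A) = 1 - real (card {S \<in> A. \<not> Q S}) / real (card A)"
    by (simp add: diff_divide_distrib)
  then show ?thesis using assms by (simp add: measure_pmf_of_set)
qed

section \<open>Numerical estimates for the sample size and the error terms\<close>

lemma sample_size_bounds:
  fixes N :: nat and fr :: real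
  assumes "0 < fr" "fr \<le> 1/2"
  defines "m \<equiv> nat \<lceil>real N * fr\<rceil>"
  shows "real N * fr \<le> real m" "2 * m \<le> N + 1" "0 < N \<Longrightarrow> 0 < m"
proof -
  have nn: "0 \<le> real N * fr" using assms by simp
  show "real N * fr \<le> real m" unfolding m_def using nn by linarith
  have "real m < real N * fr + 1" unfolding m_def using nn by linarith
  moreover have "real N * fr \<le> real N * (1/2)" using assms by (intro mult_left_mono) auto
  \<comment> \<open>Rounding up costs less than 1, so \<open>2 * m\<close> stays below
    \<open>N + 2\<close>; integrality then gives \<open>N + 1\<close>.\<close>
  ultimately have "real (2 * m) < real (N + 2)" by simp
  then show "2 * m \<le> N + 1" by simp
  show "0 < m" if "0 < N"
  proof -
    have "0 < real N * fr" using that assms by simp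
    then have "0 < real m" using \<open>real N * fr \<le> real m\<close> by linarith
    then show ?thesis by simp
  qed
qed

text \<open>The factor 2 from contraction is absorbed by \<open>1 / sqrt (fr * (1 - fr))\<close>,
  which is at least 2, and the ratio of \<open>sqrt m\<close> to \<open>sqrt k\<close> by
  \<open>sqrt 2\<close>.\<close>

lemma complexity_term_le:
  fixes l C fr \<rho> :: real
  assumes "0 \<le> l" "0 < C" "0 < fr" "fr \<le> 1/2" "0 < \<rho>" "0 < k" "m \<le> 2 * k"
  shows "2 * (1 / \<rho>) * (C * l * sqrt (real m)) / sqrt (real k) \<le> C * l * sqrt 2 / (\<rho> * sqrt (fr * (1 - fr)))"
proof -
  have "(fr - 1/2)\<^sup>2 \<ge> 0" by simp
  then have "fr * (1 - fr) \<le> (1/2)\<^sup>2" by (simp add: power2_eq_square algebra_simps)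
  then have "sqrt (fr * (1 - fr)) \<le> 1/2" by (intro real_le_lsqrt) auto
  moreover have pos: "0 < sqrt (fr * (1 - fr))" using assms by simp
  ultimately have a: "2 \<le> 1 / sqrt (fr * (1 - fr))" by (simp add: le_divide_eq)
  have "real m \<le> 2 * real k" using assms(7) by linarith
  then have "sqrt (real m) \<le> sqrt 2 * sqrt (real k)"
    unfolding real_sqrt_mult[symmetric] by simp
  then have b: "sqrt (real m) / sqrt (real k) \<le> sqrt 2" using assms(6) by (simp add: divide_le_eq)
  have "2 * (1 / \<rho>) * (C * l * sqrt (real m)) / sqrt (real k)
      = C * l / \<rho> * (2 * (sqrt (real m) / sqrt (real k)))" by simp
  also have "\<dots> \<le> C * l / \<rho> * ((1 / sqrt (fr * (1 - fr))) * sqrt 2)"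
    using assms a b pos by (intro mult_left_mono mult_mono) auto
  also have "\<dots> = C * l * sqrt 2 / (\<rho> * sqrt (fr * (1 - fr)))" by simp
  finally show ?thesis .
qed

text \<open>With \<open>u = N - m\<close>, the quantity \<open>m * c\<^sup>2\<close> equals
  \<open>B\<^sup>2 * (N / u)\<^sup>2 / m\<close>, which is at most
  \<open>9 * B\<^sup>2 / (N * fr)\<close>. The size of the exponent is then at least twice
  \<open>ln (1 / \<delta>)\<close>, more than the estimate asks for.\<close>

lemma confidence_term_le:
  fixes B fr \<delta> :: real
  assumes "0 < B" "0 < fr" "fr \<le> 1/2" "0 < \<delta>" "\<delta> < 1" "0 < m" "m < N" "real N * fr \<le> real m" "2 * m \<le> N + 1"
  defines "c \<equiv> B * (1 / real m + 1 / real (N - m))"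
  shows "exp (- 2 * (3 * B / (1 - fr) * sqrt (ln (1 / \<delta>) / (real N * fr)))\<^sup>2 / (real m * c\<^sup>2)) \<le> \<delta>"
proof -
  define u where "u = N - m"
  define Ln where "Ln = ln (1 / \<delta>)"
  have Ln: "0 < Ln" unfolding Ln_def using assms by simp
  \<comment> \<open>\<open>2 * m \<le> N + 1\<close> gives \<open>m \<le> u + 1 \<le> 2 * u\<close>,
    whence \<open>N \<le> 3 * u\<close>. This is the source of the constant 3.\<close>
  have N: "N = m + u" "0 < u" "N \<le> 3 * u" unfolding u_def using assms by auto
  have c: "c = B * (real N / real u) / real m"
    unfolding c_def u_def[symmetric] using N(2) assms(6) by (simp add: N(1) field_simps)
  have "0 < c" unfolding c using assms N by simp
  have Nf: "0 < real N * fr" using assms by simp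
  have "real N / real u \<le> 3" using N by (simp add: divide_le_eq)
  then have "(real N / real u)\<^sup>2 \<le> 3\<^sup>2" by (intro power_mono) auto
  have "real m * c\<^sup>2 = B\<^sup>2 * (real N / real u)\<^sup>2 / real m"
    unfolding c using assms(6) by (simp add: power2_eq_square mult_ac)
  also have "\<dots> \<le> B\<^sup>2 * 3\<^sup>2 / (real N * fr)"
    using \<open>(real N / real u)\<^sup>2 \<le> 3\<^sup>2\<close> assms Nf by (intro frac_le mult_left_mono) auto
  finally have 1: "real m * c\<^sup>2 \<le> 9 * B\<^sup>2 / (real N * fr)" by (simp add: mult.commute)
  have "1 \<le> 1 / (1 - fr)" using assms by simp
  then have "1 \<le> (1 / (1 - fr))\<^sup>2" by simp
  then have "9 * B\<^sup>2 / (real N * fr) * Ln * 1 \<le> 9 * B\<^sup>2 / (real N * fr) * Ln * (2 * (1 / (1 - fr))\<^sup>2)"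
    using Nf Ln by (intro mult_left_mono) auto
  also have "\<dots> = 2 * (3 * B / (1 - fr))\<^sup>2 * (Ln / (real N * fr))"
    by (simp add: power_divide power_mult_distrib mult_ac)
  also have "\<dots> = 2 * (3 * B / (1 - fr) * sqrt (Ln / (real N * fr)))\<^sup>2"
  proof -
    have "0 \<le> Ln / (real N * fr)" using Nf Ln by simp
    then show ?thesis unfolding power_mult_distrib[of _ "sqrt _"] by simp
  qed
  finally have "Ln * (real m * c\<^sup>2) \<le> 2 * (3 * B / (1 - fr) * sqrt (Ln / (real N * fr)))\<^sup>2"
    using mult_left_mono[OF 1, of Ln] Ln by (simp add: mult_ac)
  then have "Ln \<le> 2 * (3 * B / (1 - fr) * sqrt (Ln / (real N * fr)))\<^sup>2 / (real m * c\<^sup>2)"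
    using \<open>0 < c\<close> assms(6) by (subst pos_le_divide_eq) auto
  then have "exp (- 2 * (3 * B / (1 - fr) * sqrt (Ln / (real N * fr)))\<^sup>2 / (real m * c\<^sup>2)) \<le> exp (- Ln)"
    by simp
  also have "\<dots> = \<delta>" unfolding Ln_def using assms by (simp add: ln_div)
  finally show ?thesis unfolding Ln_def .
qed

section \<open>High-probability bound for the Pref-Rank output\<close>

lemma prefrank_generalisation:
  fixes n :: nat and U :: "real mat" and \<sigma> :: "nat \<Rightarrow> nat" and ws :: "(nat \<times> nat) set \<Rightarrow> real Matrix.vec"
    and C fr \<rho> B \<delta> :: real and l :: "real \<Rightarrow> real \<Rightarrow> real"
  defines "N \<equiv> n choose 2"
  defines "m \<equiv> nat \<lceil>real N * fr\<rceil>"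
  defines "y \<equiv> \<lambda>p. sgn (real (\<sigma> (fst p)) - real (\<sigma> (snd p)))"
  defines "lam \<equiv> lambda1 (transpose_mat U * U)"
  assumes n: "n \<ge> 1" and \<sigma>: "\<sigma> permutes {0..<n}" and Lab: "in_Lab n E U"
    and C: "C > 0" and fr: "0 < fr" "fr \<le> 1/2" and \<rho>: "\<rho> > 0"
    and lB: "\<And>yy a. yy \<in> {-1, 1} \<Longrightarrow> 0 \<le> l yy a \<and> l yy a \<le> B"
    and lip: "\<And>yy a a'. yy \<in> {-1, 1} \<Longrightarrow> \<bar>l yy a - l yy a'\<bar> \<le> \<bar>a - a'\<bar> / \<rho>"
    and sol: "\<And>S. S \<in> k_subsets (pairs n) m \<Longrightarrow> is_prefrank_sol C U y S (ws S)" and \<delta>: "0 < \<delta>"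
  shows "1 - \<delta> \<le> measure_pmf.prob (pmf_of_set (k_subsets (pairs n) m))
      {S. emp_err l y (score U (ws S)) (pairs n - S) \<le> emp_err l y (score U (ws S)) S
         + C * lam * sqrt 2 / (\<rho> * sqrt (fr * (1 - fr)))
         + 3 * B / (1 - fr) * sqrt (ln (1 / \<delta>) / (real N * fr))}" (is "_ \<le> measure_pmf.prob (pmf_of_set ?A) {S. ?Q S}")
proof (cases "\<delta> < 1")
  \<comment> \<open>For \<open>\<delta> \<ge> 1\<close> the claim only says that a probability is
    nonnegative; in the other case \<open>ln (1 / \<delta>)\<close> is positive.\<close>
  case False
  then have "1 - \<delta> \<le> 0" by simp
  then show ?thesis using measure_nonneg order_trans by blast
next
  case \<delta>1: True
  let ?T1 = "C * lam * sqrt 2 / (\<rho> * sqrt (fr * (1 - fr)))"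
  let ?T2 = "3 * B / (1 - fr) * sqrt (ln (1 / \<delta>) / (real N * fr))"
  define g where "g w p = l (y p) (score U w p)" for w p
  have err: "emp_err l y (score U w) S = avg S (g w)" for w S
    by (simp add: emp_err_def avg_def g_def)
  have N: "card (pairs n) = N" by (simp add: N_def card_pairs)
  have dimU: "dim_col U = n" using Lab by (simp add: in_Lab_def)
  have lam: "0 \<le> lam"
    unfolding lam_def using dimU n by (intro gram_sum_le(1)[of _ "dim_row U" n]) auto
  have y: "y p \<in> {-1, 1}" if "p \<in> pairs n" for p
  proof -
    have "\<sigma> (fst p) \<noteq> \<sigma> (snd p)"
      using that permutes_inj[OF \<sigma>] by (metis (no_types, lifting) case_prod_beta less_irrefl mem_Collect_eq pairs_def injD)
    then show ?thesis by (auto simp: y_def sgn_if)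
  qed
  have g: "0 \<le> g w p \<and> g w p \<le> B" if "p \<in> pairs n" for w p
    unfolding g_def by (rule lB[OF y[OF that]])
  have "0 \<le> B" using lB[of 1 0] by auto
  have ln\<delta>: "0 \<le> ln (1 / \<delta>)" using \<delta> \<delta>1 by simp
  have T: "0 \<le> ?T1" "0 \<le> ?T2"
    using lam C fr \<rho> \<open>0 \<le> B\<close> ln\<delta> by (auto intro!: divide_nonneg_nonneg mult_nonneg_nonneg)
  note size = sample_size_bounds[OF fr, of N, folded m_def]
  have "m \<le> N" using size by (cases "N = 0") auto
  have A: "finite ?A" "?A \<noteq> {}"
    using card_k_subsets_pos[of "pairs n" m] \<open>m \<le> N\<close> N by auto
  show ?thesis
  proof (cases "m = N \<or> B = 0")
    \<comment> \<open>If \<open>m = N\<close> the unsampled set is empty and its error is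
      \<open>0 / 0 = 0\<close>; if \<open>B = 0\<close> all losses vanish. The first alternative
      covers \<open>N \<le> 1\<close>. In the remaining case the exchange constant is positive, as
      the tail bound demands.\<close>
    case True
    have "?Q S" if S: "S \<in> ?A" for S
    proof -
      have SP: "S \<subseteq> pairs n" "card S = m" using S by (auto simp: k_subsets_def)
      have "avg (pairs n - S) (g (ws S)) \<le> 0"
        using True
      proof
        assume "m = N"
        then have "S = pairs n" using SP N by (intro card_subset_eq) auto
        then show ?thesis by (simp add: avg_def)
      next
        assume "B = 0"
        then show ?thesis unfolding avg_def using g by (intro divide_nonpos_nonneg sum_nonpos) auto
      qed
      moreover have "0 \<le> avg S (g (ws S))"
        unfolding avg_def using g SP by (intro divide_nonneg_nonneg sum_nonneg) auto
      ultimately show ?thesis unfolding err using T by linarith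
    qed
    then have "{S \<in> ?A. \<not> ?Q S} = {}" by blast
    then have "real (card {S \<in> ?A. \<not> ?Q S}) / real (card ?A) \<le> \<delta>" using \<delta> by (simp only:) simp
    with A show ?thesis by (rule prob_pmf_of_set_ge)
  next
    case False
    then have mN: "m < N" and B: "0 < B" using \<open>m \<le> N\<close> \<open>0 \<le> B\<close> by auto
    have m: "0 < m" using size(3) mN by simp
    define k where "k = min m (N - m)"
    have k: "0 < k" "k \<le> m" "m + k \<le> N" "m \<le> 2 * k"
      unfolding k_def using mN m size(2) by auto
    \<comment> \<open>The class of all possible outputs does not depend on the drawn
      \<open>S\<close>, so a bound uniform over \<open>W\<close> covers the data-dependent
      \<open>ws S\<close>. It is finite because there are finitely many samples.\<close>
    define W where "W = ws ` ?A"
    have W: "finite W" "W \<noteq> {}" unfolding W_def using A by auto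
    define \<Lambda> where "\<Lambda> = C * lam * sqrt (real m)"
    have \<Lambda>: "0 \<le> \<Lambda>" unfolding \<Lambda>_def using C lam by simp
    have norm: "w \<bullet>\<^sub>v w \<le> \<Lambda>\<^sup>2" "w \<in> carrier_vec (dim_row U * dim_row U)" if w: "w \<in> W" for w
    proof -
      obtain S where S: "S \<in> ?A" "w = ws S" using w by (auto simp: W_def)
      have SP: "S \<subseteq> pairs n" "card S = m" using S by (auto simp: k_subsets_def)
      show "w \<bullet>\<^sub>v w \<le> \<Lambda>\<^sup>2"
        using prefrank_sol_norm_le[OF sol[OF S(1)] SP(1) _ C dimU] y SP n
        unfolding \<Lambda>_def lam_def S(2) by fastforce
      show "w \<in> carrier_vec (dim_row U * dim_row U)"
        using sol[OF S(1)] S(2) by (simp add: is_prefrank_sol_def)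
    qed
    define Z where "Z S = max_over W (\<lambda>w. avg (pairs n - S) (g w) - avg S (g w))" for S
    have "avg ?A Z \<le> 2 * (1 / \<rho>) * \<Lambda> / sqrt (real k)"
      unfolding Z_def
    proof (rule expected_deviation_le[where v = "\<lambda>p. kron_col U (fst p) (snd p)"])
      show "kron_col U (fst p) (snd p) \<in> carrier_vec (dim_row U * dim_row U)
          \<and> kron_col U (fst p) (snd p) \<bullet>\<^sub>v kron_col U (fst p) (snd p) \<le> 1" if "p \<in> pairs n" for p
        using that kron_col_norm[OF Lab] by (auto simp: pairs_def)
      show "\<bar>g w p - g w' p\<bar> \<le> 1 / \<rho> *
          \<bar>w \<bullet>\<^sub>v kron_col U (fst p) (snd p) - w' \<bullet>\<^sub>v kron_col U (fst p) (snd p)\<bar>" if "p \<in> pairs n" for p w w'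
        using lip[OF y[OF that], of "score U w p" "score U w' p"] by (simp add: g_def score_def)
    qed (use W norm \<Lambda> \<rho> k N in auto)
    also have "\<dots> \<le> ?T1"
      unfolding \<Lambda>_def by (rule complexity_term_le[OF lam C fr \<rho> k(1,4)])
    finally have mean: "avg ?A Z \<le> ?T1" .
    \<comment> \<open>The output for \<open>S\<close> is itself a member of \<open>W\<close>, so a
      failure forces \<open>Z\<close> above its mean by more than the confidence term.\<close>
    have "{S \<in> ?A. \<not> ?Q S} \<subseteq> {S \<in> ?A. avg ?A Z + ?T2 < Z S}"
    proof safe
      fix S assume S: "S \<in> ?A" "\<not> ?Q S"
      have "avg (pairs n - S) (g (ws S)) - avg S (g (ws S)) \<le> Z S"
        unfolding Z_def by (rule max_over_ge[OF W(1)]) (use S in \<open>simp add: W_def\<close>)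
      then show "avg ?A Z + ?T2 < Z S" using S(2) mean unfolding err by linarith
    qed
    then have "real (card {S \<in> ?A. \<not> ?Q S}) / real (card ?A)
        \<le> real (card {S \<in> ?A. avg ?A Z + ?T2 < Z S}) / real (card ?A)"
      using A by (intro divide_right_mono of_nat_mono card_mono) auto
    also have "\<dots> \<le> exp (- 2 * ?T2\<^sup>2 / (real m * (B * (1 / real m + 1 / real (N - m)))\<^sup>2))"
    proof (rule sampling_without_replacement_tail)
      show "swap_bounded (pairs n) m (B * (1 / real m + 1 / real (N - m))) Z"
        unfolding Z_def N[symmetric] by (rule deviation_swap_bounded) (use W m mN N g in auto)
      show "0 < B * (1 / real m + 1 / real (N - m))" using B m by (simp add: add_pos_nonneg)
    qed (use N m mN T(2) in auto)
    also have "\<dots> \<le> \<delta>"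
      by (rule confidence_term_le) (use B fr \<delta> \<delta>1 m mN size in auto)
    finally show ?thesis by (rule prob_pmf_of_set_ge[OF A])
  qed
qed

theorem theorem3:
  shows "\<exists>C1::real. C1 > 0 \<and>
    (\<forall>(n::nat) (E::nat \<Rightarrow> nat \<Rightarrow> bool) (U::real mat) (\<sigma>::nat \<Rightarrow> nat)
       (C::real) (fr::real) (\<rho>::real) (B::real) (l::real \<Rightarrow> real \<Rightarrow> real)
       (ws::(nat \<times> nat) set \<Rightarrow> real Matrix.vec) (\<delta>::real).
      let N = n choose 2;
          m = nat \<lceil>real N * fr\<rceil>;
          y = (\<lambda>p. sgn (real (\<sigma> (fst p)) - real (\<sigma> (snd p))));
          K = transpose_mat U * U;
          Samples = {S. S \<subseteq> pairs n \<and> card S = m}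
      in
      n \<ge> 1 \<and> simple_graph n E \<and> \<sigma> permutes {0..<n} \<and> in_Lab n E U
      \<and> C > 0 \<and> 0 < fr \<and> fr \<le> 1/2 \<and> \<rho> > 0
      \<and> (\<forall>yy a. yy \<in> {-1, 1} \<longrightarrow> 0 \<le> l yy a \<and> l yy a \<le> B)
      \<and> (\<forall>yy a a'. yy \<in> {-1, 1} \<longrightarrow> \<bar>l yy a - l yy a'\<bar> \<le> \<bar>a - a'\<bar> / \<rho>)
      \<and> (\<forall>S\<in>Samples. is_prefrank_sol C U y S (ws S))
      \<and> \<delta> > 0
      \<longrightarrow> measure_pmf.prob (pmf_of_set Samples)
            {S. emp_err l y (score U (ws S)) (pairs n - S)
                \<le> emp_err l y (score U (ws S)) S
                   + C * lambda1 K * sqrt 2 / (\<rho> * sqrt (fr * (1 - fr)))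
                   + C1 * B / (1 - fr) * sqrt (ln (1 / \<delta>) / (real N * fr))}
          \<ge> 1 - \<delta>)"
  unfolding Let_def k_subsets_def[symmetric]
\<comment> \<open>The constant 3 stems from \<open>N \<le> 3 * (N - m)\<close> and depends on none
  of the parameters.\<close>
proof (rule exI[of _ 3], rule conjI, simp, intro allI impI, elim conjE)
  fix n :: nat and E U \<sigma> and C fr \<rho> B :: real and l :: "real \<Rightarrow> real \<Rightarrow> real" and ws and \<delta> :: real
  assume 1: "1 \<le> n" "\<sigma> permutes {0..<n}" "in_Lab n E U" "0 < C" "0 < fr" "fr \<le> 1/2" "0 < \<rho>"
    and 2: "\<forall>yy a. yy \<in> {-1, 1} \<longrightarrow> 0 \<le> l yy a \<and> l yy a \<le> B"
    "\<forall>yy a a'. yy \<in> {-1, 1} \<longrightarrow> \<bar>l yy a - l yy a'\<bar> \<le> \<bar>a - a'\<bar> / \<rho>"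
    "\<forall>S\<in>k_subsets (pairs n) (nat \<lceil>real (n choose 2) * fr\<rceil>).
        is_prefrank_sol C U (\<lambda>p. sgn (real (\<sigma> (fst p)) - real (\<sigma> (snd p)))) S (ws S)"
    and 3: "0 < \<delta>"
  show "1 - \<delta> \<le> measure_pmf.prob (pmf_of_set (k_subsets (pairs n) (nat \<lceil>real (n choose 2) * fr\<rceil>)))
     {S. emp_err l (\<lambda>p. sgn (real (\<sigma> (fst p)) - real (\<sigma> (snd p)))) (score U (ws S)) (pairs n - S)
        \<le> emp_err l (\<lambda>p. sgn (real (\<sigma> (fst p)) - real (\<sigma> (snd p)))) (score U (ws S)) S
         + C * lambda1 (transpose_mat U * U) * sqrt 2 / (\<rho> * sqrt (fr * (1 - fr)))
         + 3 * B / (1 - fr) * sqrt (ln (1 / \<delta>) / (real (n choose 2) * fr))}"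
    by (rule prefrank_generalisation[OF 1 2(1)[rule_format] 2(2)[rule_format] 2(3)[rule_format] 3])
qed

end
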